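(* Let $\Omega\subset\mathbb R^n$ be bounded and open, let $1<p<\infty$, and let $u\in C(\Omega)\cap W^{1,p}(\Omega)$ be $p$-harmonic. If $w-u\in W^{1,p}_0(\Omega)$, then $$E_p(w;\Omega)\ge E_p(u;\Omega),$$ with equality if and only if $w=u$ almost everywhere. Consequently, if the continuous representative of $u$ is not smooth, every smooth function with the same Sobolev boundary values (i.e. every smooth $w$ with $w-u\in W^{1,p}_0(\Omega)$) has strictly greater energy.
   Context: $E_p(v;\Omega)=\int_\Omega|\nabla v|^p\,dx$. $W^{1,p}_0(\Omega)$ is the closure of $C_c^\infty(\Omega)$ in $W^{1,p}(\Omega)$. A continuous $u\in W^{1,p}_{\mathrm{loc}}(\Omega)$ is $p$-harmonic if $\int_\Omega|\nabla u|^{p-2}\nabla u\cdot\nabla\varphi\,dx=0$ for all $\varphi\in C_c^\infty(\Omega)$ (with $|\nabla u|^{p-2}\nabla u:=0$ where $\nabla u=0$). *)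

theory Defs
  imports "HOL-Analysis.Analysis"
begin

text \<open>
  Functions on an open set \<open>\<Omega>\<close> are represented by total functions; values outside \<open>\<Omega>\<close> are
  irrelevant. Elements of Lebesgue and Sobolev spaces are functions, not classes modulo
  null sets.
\<close>

subsection \<open>Smooth functions and test functions\<close>

definition partial_deriv :: "('a::euclidean_space \<Rightarrow> real) \<Rightarrow> 'a \<Rightarrow> 'a \<Rightarrow> real" where
  "partial_deriv f b x = frechet_derivative f (at x) b"

definition gradient :: "('a::euclidean_space \<Rightarrow> real) \<Rightarrow> 'a \<Rightarrow> 'a" where
  "gradient f x = (\<Sum>b\<in>Basis. partial_deriv f b x *\<^sub>R b)"

text \<open>Meant for open sets, since the derivatives are unrestricted ones.\<close>

primrec Ck_on :: "nat \<Rightarrow> 'a::euclidean_space set \<Rightarrow> ('a \<Rightarrow> real) \<Rightarrow> bool" where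
  "Ck_on 0 S f \<longleftrightarrow> continuous_on S f"
| "Ck_on (Suc k) S f \<longleftrightarrow>
     (\<forall>x\<in>S. f differentiable (at x)) \<and> (\<forall>b\<in>Basis. Ck_on k S (partial_deriv f b))"

definition smooth_on :: "'a::euclidean_space set \<Rightarrow> ('a \<Rightarrow> real) \<Rightarrow> bool" where
  "smooth_on S f \<longleftrightarrow> (\<forall>k. Ck_on k S f)"

text \<open>\<open>C\<^sub>c\<^sup>\<infinity>(\<Omega>)\<close>, each function being extended by zero to the whole space.\<close>

definition test_functions :: "'a::euclidean_space set \<Rightarrow> ('a \<Rightarrow> real) set" where
  "test_functions \<Omega> =
     {\<phi>. smooth_on UNIV \<phi> \<and> compact (closure {x. \<phi> x \<noteq> 0}) \<and> closure {x. \<phi> x \<noteq> 0} \<subseteq> \<Omega>}"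

subsection \<open>Sobolev spaces\<close>

definition Lp_space :: "real \<Rightarrow> 'a::euclidean_space set \<Rightarrow> ('a \<Rightarrow> 'b::euclidean_space) set" where
  "Lp_space p \<Omega> = {f. f \<in> borel_measurable (lebesgue_on \<Omega>) \<and>
                     (\<lambda>x. norm (f x) powr p) absolutely_integrable_on \<Omega>}"

definition Lp_loc :: "real \<Rightarrow> 'a::euclidean_space set \<Rightarrow> ('a \<Rightarrow> 'b::euclidean_space) set" where
  "Lp_loc p \<Omega> = {f. \<forall>K. compact K \<and> K \<subseteq> \<Omega> \<longrightarrow> f \<in> Lp_space p K}"

definition locally_integrable_on ::
    "('a::euclidean_space \<Rightarrow> 'b::euclidean_space) \<Rightarrow> 'a set \<Rightarrow> bool"
    (infixr "locally'_integrable'_on" 46) where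
  "f locally_integrable_on \<Omega> \<longleftrightarrow> (\<forall>K. compact K \<and> K \<subseteq> \<Omega> \<longrightarrow> f absolutely_integrable_on K)"

definition has_weak_gradient ::
    "('a::euclidean_space \<Rightarrow> real) \<Rightarrow> ('a \<Rightarrow> 'a) \<Rightarrow> 'a set \<Rightarrow> bool" where
  "has_weak_gradient u g \<Omega> \<longleftrightarrow>
     u locally_integrable_on \<Omega> \<and> g locally_integrable_on \<Omega> \<and>
     (\<forall>\<phi>\<in>test_functions \<Omega>. \<forall>b\<in>Basis.
        (LINT x:\<Omega>|lebesgue. u x * partial_deriv \<phi> b x)
          = - (LINT x:\<Omega>|lebesgue. (g x \<bullet> b) * \<phi> x))"

text \<open>
  Weak gradients on an open set are unique up to null sets, so the choice below does not
  affect any integral.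
\<close>

definition weak_gradient :: "'a::euclidean_space set \<Rightarrow> ('a \<Rightarrow> real) \<Rightarrow> 'a \<Rightarrow> 'a" where
  "weak_gradient \<Omega> u = (SOME g. has_weak_gradient u g \<Omega>)"

definition W1p :: "real \<Rightarrow> 'a::euclidean_space set \<Rightarrow> ('a \<Rightarrow> real) set" where
  "W1p p \<Omega> = {u. u \<in> Lp_space p \<Omega> \<and> (\<exists>g. has_weak_gradient u g \<Omega> \<and> g \<in> Lp_space p \<Omega>)}"

definition W1p_loc :: "real \<Rightarrow> 'a::euclidean_space set \<Rightarrow> ('a \<Rightarrow> real) set" where
  "W1p_loc p \<Omega> = {u. u \<in> Lp_loc p \<Omega> \<and> (\<exists>g. has_weak_gradient u g \<Omega> \<and> g \<in> Lp_loc p \<Omega>)}"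

text \<open>
  For functions in \<open>W\<^sup>1\<^sup>,\<^sup>p(\<Omega>)\<close> the integrals in the next two definitions converge; outside that
  space they may take the default value 0.
\<close>

definition p_energy :: "real \<Rightarrow> ('a::euclidean_space \<Rightarrow> real) \<Rightarrow> 'a set \<Rightarrow> real" where
  "p_energy p v \<Omega> = (LINT x:\<Omega>|lebesgue. norm (weak_gradient \<Omega> v x) powr p)"

definition W1p_norm :: "real \<Rightarrow> 'a::euclidean_space set \<Rightarrow> ('a \<Rightarrow> real) \<Rightarrow> real" where
  "W1p_norm p \<Omega> v =
     ((LINT x:\<Omega>|lebesgue. \<bar>v x\<bar> powr p)
      + (LINT x:\<Omega>|lebesgue. norm (weak_gradient \<Omega> v x) powr p)) powr (1 / p)"

definition W1p_0 :: "real \<Rightarrow> 'a::euclidean_space set \<Rightarrow> ('a \<Rightarrow> real) set" where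
  "W1p_0 p \<Omega> = {v \<in> W1p p \<Omega>. \<forall>\<epsilon>>0. \<exists>\<phi>\<in>test_functions \<Omega>. W1p_norm p \<Omega> (\<lambda>x. v x - \<phi> x) < \<epsilon>}"

subsection \<open>p-harmonic functions\<close>

text \<open>
  The convention that \<open>|\<nabla>u|\<^sup>p\<^sup>-\<^sup>2 \<nabla>u\<close> vanishes where \<open>\<nabla>u = 0\<close> holds automatically, also for
  \<open>p < 2\<close>, because the scalar factor is finite and multiplies the zero vector.
\<close>

definition p_harmonic_on ::
    "real \<Rightarrow> 'a::euclidean_space set \<Rightarrow> ('a \<Rightarrow> real) \<Rightarrow> bool" where
  "p_harmonic_on p \<Omega> u \<longleftrightarrow>
     continuous_on \<Omega> u \<and> u \<in> W1p_loc p \<Omega> \<and>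
     (\<forall>\<phi>\<in>test_functions \<Omega>.
        (LINT x:\<Omega>|lebesgue.
           (norm (weak_gradient \<Omega> u x) powr (p - 2) *\<^sub>R weak_gradient \<Omega> u x) \<bullet> gradient \<phi> x) = 0)"

end

theory Submission
  imports Defs
begin

text \<open>
  Write \<open>h = w - u\<close>. Strict convexity of \<open>|\<cdot>|\<^sup>p\<close> bounds \<open>|\<nabla>u + \<nabla>h|\<^sup>p\<close> from below by its tangent
  \<open>|\<nabla>u|\<^sup>p + p |\<nabla>u|\<^sup>p\<^sup>-\<^sup>2 \<nabla>u \<cdot> \<nabla>h\<close>, with equality only where \<open>\<nabla>h = 0\<close>. The linear term integrates to zero:
  this is the equation for test functions, and it extends to \<open>h\<close> in \<open>W\<^sub>0\<close> by approximation. If the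
  energies agree, then \<open>\<nabla>h = 0\<close> almost everywhere, and the Poincare inequality for test functions
  forces \<open>h = 0\<close>. A smooth \<open>w\<close> of equal energy would therefore coincide on \<open>\<Omega>\<close> with the
  continuous representative of \<open>u\<close>, which is not smooth. Since the energy is evaluated at a chosen
  weak gradient, uniqueness of weak gradients up to null sets is needed throughout; it rests on
  test functions that approximate indicators of compact sets.
\<close>

subsection \<open>Smooth cutoff functions\<close>

text \<open>Both claims are read off one function: the gap between
  \<open>|\<nabla>u + \<nabla>h|^p\<close> and its tangent is nonnegative, vanishes exactly where
  \<nabla>h does, and integrates to the energy difference. Carrying the equation from test functions
  to \<open>h\<close> needs continuity in L^p of the pairing with the flux
  \<open>|\<nabla>u|^(p-2) \<nabla>u\<close>. In place of Hoelder's inequality, Young's inequality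
  with a free weight \<epsilon> is integrated; the same inequality absorbs the error term in the
  Poincare estimate, and the crude bound \<open>|a + b|^p \<le> 2^p (|a|^p + |b|^p)\<close> stands
  in for Minkowski's inequality. The Poincare estimate, where boundedness of \<Omega> enters,
  reaches \<open>h\<close> through its approximants \<phi>: if \<nabla>h = 0, then \<nabla>\<phi> is
  small in L^p, hence so is \<phi>, which is close to \<open>h\<close>. For uniqueness of weak
  gradients no mollification is used. Integrals over compact sets are shown to vanish, and inner
  regularity of Lebesgue measure does the rest. The cutoffs need only be close to 1 on the compact
  set, so explicit expressions in \<open>exp (- 1 / t)\<close> suffice.\<close>

lemma partial_deriv_eq: "(f has_derivative f') (at x) \<Longrightarrow> partial_deriv f b x = f' b"
  unfolding partial_deriv_def using frechet_derivative_at by metis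

text \<open>The standard flat function \<open>exp (- 1 / t)\<close> is the case
  \<open>m = 0\<close>. The extra powers of \<open>1 / t\<close> make the family closed under
  differentiation up to linear combinations.\<close>

definition flat :: "nat \<Rightarrow> real \<Rightarrow> real" where
  "flat m t = (if t \<le> 0 then 0 else exp (- 1 / t) / t ^ m)"

text \<open>On the right of 0 the substitution \<open>s = 1 / t\<close> turns the claim into
  \<open>s ^ m / exp s\<close> tending to 0 at infinity.\<close>

lemma flat_tendsto_0: "(flat m \<longlongrightarrow> 0) (at 0)"
proof (rule filterlim_split_at)
  show "(flat m \<longlongrightarrow> 0) (at_left 0)"
    by (rule tendsto_eventually) (auto simp: flat_def eventually_at_left_field intro: exI[of _ "-1"])
  have "((\<lambda>t. inverse t ^ m / exp (inverse t)) \<longlongrightarrow> 0) (at_right (0::real))"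
    by (rule filterlim_compose[OF tendsto_power_div_exp_0 filterlim_inverse_at_top_right])
  moreover have "\<forall>\<^sub>F t in at_right (0::real). inverse t ^ m / exp (inverse t) = flat m t"
    unfolding eventually_at_right_field
    by (rule exI[of _ 1]) (auto simp: flat_def exp_minus field_simps)
  ultimately show "(flat m \<longlongrightarrow> 0) (at_right 0)"
    by (rule Lim_transform_eventually)
qed

lemma flat_has_real_derivative:
  "(flat m has_real_derivative flat (Suc (Suc m)) t - real m * flat (Suc m) t) (at t)"
proof -
  consider "t < 0" | "t = 0" | "t > 0" by linarith
  then show ?thesis
  proof cases
    case 1
    have "((\<lambda>_. 0) has_real_derivative 0) (at t)" by simp
    then have "(flat m has_real_derivative 0) (at t)"
      by (rule has_field_derivative_transform_within_open[where S="{..<0}"]) (use 1 in \<open>auto simp: flat_def\<close>)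
    with 1 show ?thesis by (simp add: flat_def)
  next
    case 2
    \<comment> \<open>The difference quotient at 0 is the next member of the family, whose limit
      there is already known.\<close>
    have "flat m y / y = flat (Suc m) y" for y by (simp add: flat_def)
    then have "(flat m has_real_derivative 0) (at 0)"
      using flat_tendsto_0[of "Suc m"] by (simp add: has_field_derivative_iff flat_def[of m 0])
    with 2 show ?thesis by (simp add: flat_def)
  next
    case 3
    have "((\<lambda>t. exp (- 1 / t) / t ^ m) has_real_derivative
        exp (- 1 / t) / t ^ Suc (Suc m) - real m * (exp (- 1 / t) / t ^ Suc m)) (at t)"
    \<comment> \<open>The power rule produces the truncated exponent \<open>m - 1\<close>, so
      \<open>m = 0\<close> is treated apart.\<close>
    proof (cases m)
      case 0
      show ?thesis unfolding 0
        by (rule derivative_eq_intros refl | use 3 in \<open>simp add: power2_eq_square\<close>)+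
    next
      case (Suc k)
      show ?thesis unfolding Suc
        by (rule derivative_eq_intros refl | use 3 in \<open>simp add: field_simps\<close>)+
    qed
    then have "(flat m has_real_derivative
        exp (- 1 / t) / t ^ Suc (Suc m) - real m * (exp (- 1 / t) / t ^ Suc m)) (at t)"
      by (rule has_field_derivative_transform_within_open[where S="{0<..}"]) (use 3 in \<open>auto simp: flat_def\<close>)
    with 3 show ?thesis by (simp add: flat_def)
  qed
qed

text \<open>
  Membership in a class of differentiable functions that is closed under partial derivatives gives
  smoothness of all orders at once, without product and chain rules for \<^const>\<open>Ck_on\<close>.
\<close>

inductive flat_generated :: "('a::euclidean_space \<Rightarrow> real) \<Rightarrow> bool" where
  const: "flat_generated (\<lambda>_. c)"
| coord: "flat_generated (\<lambda>x. x \<bullet> a)"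
| add: "flat_generated f \<Longrightarrow> flat_generated g \<Longrightarrow> flat_generated (\<lambda>x. f x + g x)"
| mult: "flat_generated f \<Longrightarrow> flat_generated g \<Longrightarrow> flat_generated (\<lambda>x. f x * g x)"
| flat: "flat_generated f \<Longrightarrow> flat_generated (\<lambda>x. flat m (f x))"

lemma flat_generated_sum:
  "finite A \<Longrightarrow> (\<And>a. a \<in> A \<Longrightarrow> flat_generated (f a)) \<Longrightarrow> flat_generated (\<lambda>x. \<Sum>a\<in>A. f a x)"
  by (induction A rule: finite_induct) (auto intro: flat_generated.intros)

lemma flat_generated_derivative:
  assumes "flat_generated f"
  shows "(\<forall>x. f differentiable (at x)) \<and> (\<forall>b. flat_generated (partial_deriv f b))"
  using assms
proof induction
  case (const c)
  have "partial_deriv (\<lambda>_. c) b = (\<lambda>_::'a. 0)" for b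
    by (rule ext) (simp add: partial_deriv_eq[OF has_derivative_const])
  then show ?case by (simp add: flat_generated.const)
next
  case (coord a)
  have d: "((\<lambda>x. x \<bullet> a) has_derivative (\<lambda>x. x \<bullet> a)) (at x)" for x
    by (intro derivative_intros)
  have "partial_deriv (\<lambda>x. x \<bullet> a) b = (\<lambda>_. b \<bullet> a)" for b
    by (rule ext) (simp add: partial_deriv_eq[OF d])
  then show ?case using d by (auto simp: flat_generated.const differentiable_def)
next
  case (add f g)
  have d: "((\<lambda>x. f x + g x) has_derivative
      (\<lambda>h. frechet_derivative f (at x) h + frechet_derivative g (at x) h)) (at x)" for x
    using add.IH by (intro derivative_intros) (auto simp: frechet_derivative_works[symmetric])
  have "partial_deriv (\<lambda>x. f x + g x) b = (\<lambda>x. partial_deriv f b x + partial_deriv g b x)" for b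
    by (rule ext) (simp add: partial_deriv_eq[OF d], simp add: partial_deriv_def)
  then show ?case using d add.IH by (auto simp: differentiable_def intro: flat_generated.add)
next
  case (mult f g)
  have d: "((\<lambda>x. f x * g x) has_derivative
      (\<lambda>h. f x * frechet_derivative g (at x) h + frechet_derivative f (at x) h * g x)) (at x)" for x
    using mult.IH by (intro derivative_intros) (auto simp: frechet_derivative_works[symmetric])
  have "partial_deriv (\<lambda>x. f x * g x) b = (\<lambda>x. f x * partial_deriv g b x + partial_deriv f b x * g x)" for b
    by (rule ext) (simp add: partial_deriv_eq[OF d], simp add: partial_deriv_def)
  then show ?case using d mult
    by (auto simp: differentiable_def intro!: flat_generated.add flat_generated.mult)
next
  case (flat f m)
  let ?D = "\<lambda>t. flat (Suc (Suc m)) t - real m * flat (Suc m) t"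
  have d: "((\<lambda>x. flat m (f x)) has_derivative
      (\<lambda>h. ?D (f x) * frechet_derivative f (at x) h)) (at x)" for x
    using flat.IH flat_has_real_derivative[of m "f x"]
    by (intro has_derivative_compose[of f _ x UNIV "flat m" "(*) (?D (f x))"])
       (auto simp: has_field_derivative_def frechet_derivative_works[symmetric])
  \<comment> \<open>The subtraction is written as a product with the constant
    \<open>- real m\<close>, since the class is generated by sums and products only.\<close>
  have "partial_deriv (\<lambda>x. flat m (f x)) b =
      (\<lambda>x. (flat (Suc (Suc m)) (f x) + (- real m) * flat (Suc m) (f x)) * partial_deriv f b x)" for b
    by (rule ext) (simp add: partial_deriv_eq[OF d], simp add: partial_deriv_def)
  moreover have "flat_generated (\<lambda>x. (flat (Suc (Suc m)) (f x) + (- real m) * flat (Suc m) (f x)) * partial_deriv f b x)" for b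
    using flat by (intro flat_generated.intros) auto
  ultimately show ?case using d by (auto simp: differentiable_def)
qed

lemma smooth_on_flat_generated:
  assumes "flat_generated f"
  shows "smooth_on S f"
proof -
  have "Ck_on k S f" for k
    using assms
  proof (induction k arbitrary: f)
    case 0
    then have "continuous (at x) f" for x
      using flat_generated_derivative differentiable_imp_continuous_within by blast
    then show ?case by (simp add: continuous_at_imp_continuous_on)
  next
    case (Suc k)
    then show ?case using flat_generated_derivative by auto
  qed
  then show ?thesis by (simp add: smooth_on_def)
qed

text \<open>This is \<open>1 + y \<le> exp y\<close> at \<open>y = - 1 / t\<close>. It shows that
  \<open>flat 0\<close> comes as close to 1 as desired at large arguments.\<close>

lemma flat_ge: "t > 0 \<Longrightarrow> 1 - 1 / t \<le> flat 0 t"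
  using exp_ge_add_one_self[of "- 1 / t"] by (simp add: flat_def)

lemma flat_0_bounds: "0 \<le> flat 0 t" "flat 0 t \<le> 1"
  by (auto simp: flat_def)

text \<open>The closed neighbourhood is the Minkowski sum of \<open>K\<close> and a closed ball
  around 0.\<close>

lemma compact_UN_cball:
  fixes K :: "'a::euclidean_space set"
  assumes "compact K"
  shows "compact (\<Union>y\<in>K. cball y \<epsilon>)"
proof -
  have "(\<Union>y\<in>K. cball y \<epsilon>) = {x + y |x y. x \<in> K \<and> y \<in> cball 0 \<epsilon>}"
  proof (intro equalityI subsetI)
    fix z assume "z \<in> (\<Union>y\<in>K. cball y \<epsilon>)"
    then obtain y where "y \<in> K" "dist y z \<le> \<epsilon>" by auto
    then have "z = y + (z - y)" "z - y \<in> cball 0 \<epsilon>" by (auto simp: dist_norm norm_minus_commute)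
    then show "z \<in> {x + y |x y. x \<in> K \<and> y \<in> cball 0 \<epsilon>}" using \<open>y \<in> K\<close> by blast
  qed (force simp: dist_norm)
  then show ?thesis by (simp only:) (rule compact_sums[OF assms compact_cball])
qed

text \<open>Finitely many radial bumps cover \<open>K\<close>, so their sum \<sigma> has a positive
  lower bound there. Applying \<open>flat 0\<close> to a large multiple of \<sigma> lifts the values
  on \<open>K\<close> towards 1, keeps all values in [0, 1] and preserves the zeros. Since
  \<open>flat 0\<close> never attains 1, the deficit \<delta> remains.\<close>

lemma test_function_near_indicator:
  fixes K :: "'a::euclidean_space set"
  assumes K: "compact K" and "\<epsilon> > 0" and sub: "(\<Union>x\<in>K. cball x \<epsilon>) \<subseteq> \<Omega>" and "\<delta> > 0"
  obtains \<psi> where "\<psi> \<in> test_functions \<Omega>" "\<And>x. 0 \<le> \<psi> x" "\<And>x. \<psi> x \<le> 1"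
    "\<And>x. x \<in> K \<Longrightarrow> 1 - \<delta> \<le> \<psi> x" "\<And>x. x \<notin> (\<Union>y\<in>K. cball y \<epsilon>) \<Longrightarrow> \<psi> x = 0"
proof -
  have "K \<subseteq> (\<Union>a\<in>K. ball a \<epsilon>)" using \<open>\<epsilon> > 0\<close> by force
  from compactE_image[OF K open_ball this] obtain A
    where A: "finite A" "A \<subseteq> K" "K \<subseteq> (\<Union>a\<in>A. ball a \<epsilon>)" by metis
  define \<sigma> where "\<sigma> x = (\<Sum>a\<in>A. flat 0 (\<epsilon>\<^sup>2 - (dist a x)\<^sup>2))" for x
  have gen: "flat_generated \<sigma>"
  proof -
    have "flat_generated (\<lambda>x. \<epsilon>\<^sup>2 - (dist a x)\<^sup>2)" for a :: 'a
    proof -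
      \<comment> \<open>The squared distance is spelled out in coordinates, using only the
        operations that generate the class.\<close>
      have "(\<lambda>x. \<epsilon>\<^sup>2 - (dist a x)\<^sup>2) =
          (\<lambda>x. \<epsilon>\<^sup>2 + (-1) * (\<Sum>b\<in>Basis. (x \<bullet> b + (- (a \<bullet> b))) * (x \<bullet> b + (- (a \<bullet> b)))))"
      proof
        fix x
        have "(dist a x)\<^sup>2 = (\<Sum>b\<in>Basis. ((x - a) \<bullet> b) * ((x - a) \<bullet> b))"
          by (subst euclidean_inner[symmetric]) (metis dist_commute dist_norm power2_norm_eq_inner)
        then show "\<epsilon>\<^sup>2 - (dist a x)\<^sup>2 =
            \<epsilon>\<^sup>2 + (-1) * (\<Sum>b\<in>Basis. (x \<bullet> b + (- (a \<bullet> b))) * (x \<bullet> b + (- (a \<bullet> b))))"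
          by (simp add: inner_diff_left)
      qed
      then show ?thesis
        by (simp only:) (intro flat_generated.intros flat_generated_sum finite_Basis)
    qed
    then have "flat_generated (\<lambda>x. flat 0 (\<epsilon>\<^sup>2 - (dist a x)\<^sup>2))" for a :: 'a
      by (rule flat_generated.flat)
    then show ?thesis
      unfolding \<sigma>_def by (intro flat_generated_sum A(1))
  qed
  have pos: "\<sigma> x > 0" if "x \<in> K" for x
  proof -
    obtain a where "a \<in> A" "dist a x < \<epsilon>" using subsetD[OF A(3) \<open>x \<in> K\<close>] by auto
    then have "flat 0 (\<epsilon>\<^sup>2 - (dist a x)\<^sup>2) > 0"
      using power_strict_mono[of "dist a x" \<epsilon> 2] by (simp add: flat_def)
    then show ?thesis
      unfolding \<sigma>_def using A(1) \<open>a \<in> A\<close>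
      by (intro sum_pos2[of A a]) (auto simp: flat_0_bounds)
  qed
  have zero: "\<sigma> x = 0" if "x \<notin> (\<Union>y\<in>K. cball y \<epsilon>)" for x
  proof -
    have "dist a x > \<epsilon>" if "a \<in> A" for a using A that \<open>x \<notin> _\<close> by force
    then show ?thesis
      unfolding \<sigma>_def using \<open>\<epsilon> > 0\<close>
      by (intro sum.neutral ballI) (auto simp: flat_def intro: power_mono less_imp_le)
  qed
  have cont: "continuous_on K \<sigma>"
    using smooth_on_flat_generated[OF gen, of K] unfolding smooth_on_def by (metis Ck_on.simps(1))
  obtain c where c: "c > 0" "\<And>x. x \<in> K \<Longrightarrow> c \<le> \<sigma> x"
  proof (cases "K = {}")
    case False
    then obtain x0 where "x0 \<in> K" "\<And>x. x \<in> K \<Longrightarrow> \<sigma> x0 \<le> \<sigma> x"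
      using continuous_attains_inf[OF K False cont] by auto
    then show ?thesis using pos that by blast
  qed (use that[of 1] in auto)
  \<comment> \<open>With this factor \<open>1 / (m * c) = \<delta>\<close>, which is the deficit
    that \<open>flat_ge\<close> leaves wherever \<sigma> is at least \<open>c\<close>.\<close>
  define m where "m = 1 / (\<delta> * c)"
  have "m > 0" using c \<open>\<delta> > 0\<close> by (simp add: m_def)
  define \<psi> where "\<psi> x = flat 0 (m * \<sigma> x)" for x
  have psi0: "\<psi> x = 0" if "x \<notin> (\<Union>y\<in>K. cball y \<epsilon>)" for x
    using zero[OF that] by (simp add: \<psi>_def flat_def)
  have cN: "compact (\<Union>y\<in>K. cball y \<epsilon>)"
    using K by (rule compact_UN_cball)
  have clos: "closure {x. \<psi> x \<noteq> 0} \<subseteq> (\<Union>y\<in>K. cball y \<epsilon>)"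
    using psi0 by (intro closure_minimal compact_imp_closed cN) blast
  show ?thesis
  proof (rule that)
    have "flat_generated \<psi>"
      unfolding \<psi>_def by (intro flat_generated.intros gen)
    then have "smooth_on UNIV \<psi>" by (rule smooth_on_flat_generated)
    moreover have "bounded {x. \<psi> x \<noteq> 0}"
      by (rule bounded_subset[OF compact_imp_bounded[OF cN] subset_trans[OF closure_subset clos]])
    moreover have "closure {x. \<psi> x \<noteq> 0} \<subseteq> \<Omega>" using clos sub by (rule subset_trans)
    ultimately show "\<psi> \<in> test_functions \<Omega>" by (simp add: test_functions_def)
    show "1 - \<delta> \<le> \<psi> x" if "x \<in> K" for x
    proof -
      have "1 / (m * \<sigma> x) \<le> 1 / (m * c)"
        using c that \<open>m > 0\<close> by (intro divide_left_mono mult_left_mono) (auto intro: mult_pos_pos pos)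
      also have "\<dots> = \<delta>" using c \<open>\<delta> > 0\<close> by (simp add: m_def)
      finally show ?thesis
        using flat_ge[of "m * \<sigma> x"] pos[OF that] \<open>m > 0\<close> by (simp add: \<psi>_def)
    qed
  qed (auto simp: \<psi>_def[abs_def] flat_0_bounds psi0[unfolded \<psi>_def])
qed

subsection \<open>Integration by parts and the Poincare inequality\<close>

lemma integrable_lborel_compact_support:
  fixes F :: "'a::euclidean_space \<Rightarrow> 'b::euclidean_space"
  assumes "continuous_on UNIV F" and "compact K" and "\<And>x. x \<notin> K \<Longrightarrow> F x = 0"
  shows "integrable lborel F"
proof -
  have "integrable lborel (\<lambda>x. indicator K x *\<^sub>R F x)"
    by (rule borel_integrable_compact[OF assms(2)]) (rule continuous_on_subset[OF assms(1)], simp)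
  moreover have "(\<lambda>x. indicator K x *\<^sub>R F x) = F"
    using assms(3) by (auto simp: indicator_def)
  ultimately show ?thesis by simp
qed

lemma integral_lborel_translate:
  fixes F :: "'a::euclidean_space \<Rightarrow> real"
  assumes "F \<in> borel_measurable borel"
  shows "(LINT x|lborel. F (c + x)) = (LINT x|lborel. F x)"
proof -
  have "(LINT x|lborel. F x) = (LINT x|distr lborel borel ((+) c). F x)"
    by (simp add: lborel_distr_plus)
  also have "\<dots> = (LINT x|lborel. F (c + x))"
    by (rule integral_distr) (use assms in auto)
  finally show ?thesis ..
qed

text \<open>
  Translation invariance makes the integrals of the difference quotients vanish; the mean value
  theorem supplies the dominating function.
\<close>

lemma integral_directional_derivative_eq_0:
  fixes F D :: "'a::euclidean_space \<Rightarrow> real"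
  assumes der: "\<And>x. ((\<lambda>t. F (x + t *\<^sub>R b)) has_real_derivative D x) (at 0)"
    and cF: "continuous_on UNIV F" and cD: "continuous_on UNIV D"
    and supp: "\<And>x. norm x > R \<Longrightarrow> F x = 0"
  shows "(LINT x|lborel. D x) = 0"
proof -
  have D0: "D x = 0" if "norm x > R" for x
  proof -
    have "open {t. norm (x + t *\<^sub>R b) > R}"
      by (intro open_Collect_less continuous_intros)
    then have "((\<lambda>t. F (x + t *\<^sub>R b)) has_real_derivative 0) (at 0)"
      by (rule has_field_derivative_transform_within_open[OF DERIV_const[of 0]])
         (use that supp in auto)
    then show ?thesis using DERIV_unique der by blast
  qed
  have "bounded (D ` cball 0 R)"
    by (intro compact_imp_bounded compact_continuous_image continuous_on_subset[OF cD]) auto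
  then obtain M0 where "\<forall>y \<in> D ` cball 0 R. norm y \<le> M0"
    unfolding bounded_iff by blast
  then have M0: "\<bar>D x\<bar> \<le> M0" if "norm x \<le> R" for x
    using that by auto
  define M where "M = max M0 0"
  have M: "\<bar>D x\<bar> \<le> M" for x
    using M0[of x] D0[of x] by (cases "norm x \<le> R") (auto simp: M_def)
  \<comment> \<open>The hypothesis speaks only of parameter 0; restarting the line at
    \<open>x + s *\<^sub>R b\<close> gives the derivative at every parameter, as the mean value
    theorem requires.\<close>
  have der': "((\<lambda>t. F (x + t *\<^sub>R b)) has_real_derivative D (x + s *\<^sub>R b)) (at s)" for x s
    using der[of "x + s *\<^sub>R b"] DERIV_shift[of "\<lambda>t. F (x + t *\<^sub>R b)" "D (x + s *\<^sub>R b)" 0 s]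
    by (simp add: algebra_simps)
  define s where "s n = inverse (real (Suc n))" for n
  have s: "s n > 0" "s n \<le> 1" for n
    by (auto simp: s_def inverse_le_1_iff)
  define G where "G n x = (F (s n *\<^sub>R b + x) - F x) / s n" for n x
  have intF: "integrable lborel F"
    by (rule integrable_lborel_compact_support[OF cF, of "cball 0 R"]) (auto intro: supp)
  have mF [measurable]: "F \<in> borel_measurable borel"
    using cF by (rule borel_measurable_continuous_onI)
  have mD [measurable]: "D \<in> borel_measurable borel"
    using cD by (rule borel_measurable_continuous_onI)
  have mG [measurable]: "G n \<in> borel_measurable borel" for n
    unfolding G_def by measurable
  have Gint: "(LINT x|lborel. G n x) = 0" for n
  proof -
    have "continuous_on UNIV (\<lambda>x. F (s n *\<^sub>R b + x))"
      by (rule continuous_on_compose2[OF cF]) (auto intro: continuous_intros)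
    moreover have "F (s n *\<^sub>R b + x) = 0" if "x \<notin> cball (- (s n *\<^sub>R b)) R" for x
      by (rule supp) (use that in \<open>auto simp: dist_norm norm_minus_commute algebra_simps\<close>)
    ultimately have "integrable lborel (\<lambda>x. F (s n *\<^sub>R b + x))"
      using integrable_lborel_compact_support compact_cball by blast
    then show ?thesis
      using intF by (simp add: G_def integral_lborel_translate[OF mF])
  qed
  have lim: "(\<lambda>n. G n x) \<longlonglongrightarrow> D x" for x
  proof -
    have "((\<lambda>t. (F (x + t *\<^sub>R b) - F x) / t) \<longlongrightarrow> D x) (at 0)"
      using der[of x] by (simp add: has_field_derivative_iff)
    moreover have "filterlim s (at 0) sequentially"
      unfolding filterlim_at using LIMSEQ_inverse_real_of_nat s
      by (auto simp: s_def[abs_def] simp del: of_nat_Suc)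
    ultimately show ?thesis
      unfolding G_def by (auto dest: filterlim_compose simp: add.commute)
  qed
  \<comment> \<open>Because \<open>s n \<le> 1\<close>, a point of norm above
    \<open>R + norm b\<close> and its translate both lie outside the ball of radius
    \<open>R\<close>, so the quotient is 0 there. Elsewhere it is a value of
    \<open>D\<close>.\<close>
  have bound: "norm (G n x) \<le> M * indicator (cball 0 (R + norm b)) x" for n x
  proof (cases "norm x \<le> R + norm b")
    case True
    obtain z where "F (x + s n *\<^sub>R b) - F (x + 0 *\<^sub>R b) = (s n - 0) * D (x + z *\<^sub>R b)"
      using MVT2[OF s(1)[of n], of "\<lambda>t. F (x + t *\<^sub>R b)" "\<lambda>t. D (x + t *\<^sub>R b)"] der' by blast
    then have "G n x = D (x + z *\<^sub>R b)"
      using s[of n] by (simp add: G_def add.commute)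
    then show ?thesis using M True by simp
  next
    case False
    have "norm (s n *\<^sub>R b) \<le> norm b"
      using s[of n] by (simp add: mult_left_le_one_le)
    moreover have "norm x \<le> norm (s n *\<^sub>R b + x) + norm (s n *\<^sub>R b)"
      using norm_triangle_ineq4[of "s n *\<^sub>R b + x" "s n *\<^sub>R b"] by simp
    ultimately have "R < norm (s n *\<^sub>R b + x)" "R < norm x" using False norm_ge_zero[of b] by linarith+
    then show ?thesis using False supp by (simp add: G_def)
  qed
  have "(\<lambda>n. LINT x|lborel. G n x) \<longlonglongrightarrow> (LINT x|lborel. D x)"
  proof (rule integral_dominated_convergence)
    show "integrable lborel (\<lambda>x. M * indicator (cball 0 (R + norm b)) x)"
      by (intro integrable_mult_right integrable_real_indicator) (use emeasure_lborel_cball_finite in auto)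
  qed (use lim bound in \<open>auto intro: AE_I2\<close>)
  then show ?thesis by (simp add: Gint LIMSEQ_const_iff)
qed

section \<open>Calculus of test functions\<close>

lemma smooth_on_UNIV_D:
  assumes "smooth_on UNIV \<phi>"
  shows "\<phi> differentiable (at x)" "continuous_on UNIV \<phi>"
    "b \<in> Basis \<Longrightarrow> continuous_on UNIV (partial_deriv \<phi> b)"
    "continuous_on UNIV (gradient \<phi>)"
proof -
  have "Ck_on (Suc 0) UNIV \<phi>" "Ck_on 0 UNIV \<phi>"
    using assms unfolding smooth_on_def by blast+
  then show "\<phi> differentiable (at x)" "continuous_on UNIV \<phi>"
    and *: "b \<in> Basis \<Longrightarrow> continuous_on UNIV (partial_deriv \<phi> b)" for b
    by auto
  show "continuous_on UNIV (gradient \<phi>)"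
    unfolding gradient_def by (intro continuous_intros *) 
qed

lemma has_real_derivative_line:
  fixes \<phi> :: "'a::euclidean_space \<Rightarrow> real"
  assumes "\<phi> differentiable (at x)"
  shows "((\<lambda>t. \<phi> (x + t *\<^sub>R b)) has_real_derivative partial_deriv \<phi> b x) (at 0)"
proof -
  have d: "(\<phi> has_derivative frechet_derivative \<phi> (at x)) (at (x + 0 *\<^sub>R b))"
    using assms by (simp add: frechet_derivative_works)
  have "((\<lambda>t. x + t *\<^sub>R b) has_derivative (\<lambda>t. t *\<^sub>R b)) (at 0)"
    by (auto intro!: derivative_eq_intros)
  from has_derivative_compose[OF this d]
  have "((\<lambda>t. \<phi> (x + t *\<^sub>R b)) has_derivative (\<lambda>t. frechet_derivative \<phi> (at x) (t *\<^sub>R b))) (at 0)" .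
  moreover have "frechet_derivative \<phi> (at x) (t *\<^sub>R b) = partial_deriv \<phi> b x * t" for t
    using linear_frechet_derivative[OF assms] by (simp add: linear_scale partial_deriv_def)
  ultimately show ?thesis by (simp add: has_field_derivative_def mult_commute_abs)
qed

lemma gradient_inner_Basis: "b \<in> Basis \<Longrightarrow> gradient f x \<bullet> b = partial_deriv f b x"
  by (simp add: gradient_def)

lemma test_function_support:
  assumes "\<phi> \<in> test_functions \<Omega>"
  obtains K where "compact K" "K \<subseteq> \<Omega>" "\<And>x. x \<notin> K \<Longrightarrow> \<phi> x = 0"
    "\<And>x b. x \<notin> K \<Longrightarrow> partial_deriv \<phi> b x = 0" "\<And>x. x \<notin> K \<Longrightarrow> gradient \<phi> x = 0"
proof -
  define K where "K = closure {x. \<phi> x \<noteq> 0}"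
  have \<phi>0: "\<phi> x = 0" if "x \<notin> K" for x
    using that closure_subset[of "{x. \<phi> x \<noteq> 0}"] by (auto simp: K_def)
  have pd: "partial_deriv \<phi> b x = 0" if "x \<notin> K" for x b
  proof -
    have "open (- K)" by (simp add: K_def open_closed)
    then have "(\<phi> has_derivative (\<lambda>_. 0)) (at x)"
      by (rule has_derivative_transform_within_open[OF has_derivative_const[of 0]])
         (use that \<phi>0 in auto)
    then show ?thesis by (rule partial_deriv_eq)
  qed
  show ?thesis
  proof (rule that[OF _ _ \<phi>0 pd])
    show "compact K" "K \<subseteq> \<Omega>" using assms by (simp_all add: test_functions_def K_def)
    show "gradient \<phi> x = 0" if "x \<notin> K" for x using pd[OF that] by (simp add: gradient_def)
  qed
qed

lemma test_functionsD:
  assumes "\<phi> \<in> test_functions \<Omega>"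
  shows "smooth_on UNIV \<phi>"
  using assms by (simp add: test_functions_def)

text \<open>The two integrands add up to the \<open>b\<close>-derivative of the product \<phi>
  \<psi>, whose support is bounded because that of \<phi> is.\<close>

lemma integration_by_parts_test_function:
  fixes \<phi> \<psi> :: "'a::euclidean_space \<Rightarrow> real"
  assumes \<phi>: "\<phi> \<in> test_functions \<Omega>" and \<psi>: "\<psi> \<in> test_functions \<Omega>'" and b: "b \<in> Basis"
  shows "(LINT x|lborel. \<phi> x * partial_deriv \<psi> b x) = - (LINT x|lborel. partial_deriv \<phi> b x * \<psi> x)"
proof -
  note s = smooth_on_UNIV_D[OF test_functionsD[OF \<phi>]] smooth_on_UNIV_D[OF test_functionsD[OF \<psi>]]
  obtain K where K: "compact K" "\<And>x. x \<notin> K \<Longrightarrow> \<phi> x = 0" "\<And>x b. x \<notin> K \<Longrightarrow> partial_deriv \<phi> b x = 0"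
    using test_function_support[OF \<phi>] by metis
  obtain R where R: "\<And>x. x \<in> K \<Longrightarrow> norm x \<le> R"
    using compact_imp_bounded[OF K(1)] by (auto simp: bounded_iff)
  have int: "integrable lborel (\<lambda>x. \<phi> x * partial_deriv \<psi> b x)"
    "integrable lborel (\<lambda>x. partial_deriv \<phi> b x * \<psi> x)"
    by (rule integrable_lborel_compact_support[OF _ K(1)]; use K s b in \<open>auto intro!: continuous_intros\<close>)+
  have "(LINT x|lborel. \<phi> x * partial_deriv \<psi> b x + partial_deriv \<phi> b x * \<psi> x) = 0"
  proof (rule integral_directional_derivative_eq_0[of "\<lambda>x. \<phi> x * \<psi> x" b _ R])
    show "((\<lambda>t. \<phi> (x + t *\<^sub>R b) * \<psi> (x + t *\<^sub>R b)) has_real_derivative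
        \<phi> x * partial_deriv \<psi> b x + partial_deriv \<phi> b x * \<psi> x) (at 0)" for x
    proof -
      have "((\<lambda>t. \<phi> (x + t *\<^sub>R b)) has_real_derivative partial_deriv \<phi> b x) (at 0)"
        "((\<lambda>t. \<psi> (x + t *\<^sub>R b)) has_real_derivative partial_deriv \<psi> b x) (at 0)"
        by (intro has_real_derivative_line s)+
      from DERIV_mult[OF this] show ?thesis by (simp add: algebra_simps)
    qed
    show "\<phi> x * \<psi> x = 0" if "R < norm x" for x
      using K(2)[of x] R[of x] that by force
  qed (use s b in \<open>auto intro!: continuous_intros\<close>)
  then show ?thesis using int by simp
qed

lemma set_lebesgue_integral_eq_lborel:
  fixes f :: "'a::euclidean_space \<Rightarrow> real"
  assumes "f \<in> borel_measurable borel" and "\<And>x. x \<notin> \<Omega> \<Longrightarrow> f x = 0"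
  shows "(LINT x:\<Omega>|lebesgue. f x) = (LINT x|lborel. f x)"
proof -
  have "(\<lambda>x. indicator \<Omega> x *\<^sub>R f x) = f"
    by (rule ext) (use assms(2) in \<open>auto simp: indicator_def\<close>)
  then show ?thesis
    using assms(1) by (simp add: set_lebesgue_integral_def integral_completion)
qed

lemma continuous_imp_locally_integrable_on:
  fixes f :: "'a::euclidean_space \<Rightarrow> 'b::euclidean_space"
  assumes "continuous_on UNIV f"
  shows "f locally_integrable_on \<Omega>"
proof -
  have "set_integrable lebesgue K f" if "compact K" for K
  proof -
    have "integrable lborel (\<lambda>x. indicator K x *\<^sub>R f x)"
      by (rule borel_integrable_compact[OF that]) (rule continuous_on_subset[OF assms], simp)
    then show ?thesis
      unfolding set_integrable_def using integrable_completion borel_measurable_integrable by blast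
  qed
  then show ?thesis by (simp add: locally_integrable_on_def)
qed

text \<open>Through this fact the Sobolev norm of \<open>v - \<phi>\<close>, formed with a chosen
  weak gradient, can be expressed by the classical gradient of \<phi>.\<close>

lemma has_weak_gradient_test_function:
  assumes \<phi>: "\<phi> \<in> test_functions \<Omega>"
  shows "has_weak_gradient \<phi> (gradient \<phi>) \<Omega>"
proof -
  note s = smooth_on_UNIV_D[OF test_functionsD[OF \<phi>]]
  obtain K where K: "K \<subseteq> \<Omega>" "\<And>x. x \<notin> K \<Longrightarrow> \<phi> x = 0" "\<And>x b. x \<notin> K \<Longrightarrow> partial_deriv \<phi> b x = 0"
    using test_function_support[OF \<phi>] by metis
  have "(LINT x:\<Omega>|lebesgue. \<phi> x * partial_deriv \<psi> b x) = - (LINT x:\<Omega>|lebesgue. (gradient \<phi> x \<bullet> b) * \<psi> x)"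
    if \<psi>: "\<psi> \<in> test_functions \<Omega>" and b: "b \<in> Basis" for \<psi> b
  proof -
    note s' = smooth_on_UNIV_D[OF test_functionsD[OF \<psi>]]
    have "(LINT x:\<Omega>|lebesgue. \<phi> x * partial_deriv \<psi> b x) = (LINT x|lborel. \<phi> x * partial_deriv \<psi> b x)"
      by (rule set_lebesgue_integral_eq_lborel)
         (use K s s' b in \<open>auto intro!: borel_measurable_continuous_onI continuous_intros\<close>)
    moreover have "(LINT x:\<Omega>|lebesgue. partial_deriv \<phi> b x * \<psi> x) = (LINT x|lborel. partial_deriv \<phi> b x * \<psi> x)"
      by (rule set_lebesgue_integral_eq_lborel)
         (use K s s' b in \<open>auto intro!: borel_measurable_continuous_onI continuous_intros\<close>)
    ultimately show ?thesis
      using integration_by_parts_test_function[OF \<phi> \<psi> b] by (simp add: gradient_inner_Basis[OF b])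
  qed
  then show ?thesis
    using s by (auto simp: has_weak_gradient_def intro: continuous_imp_locally_integrable_on)
qed

text \<open>A weighted Young inequality without sharp constants: according to whether
  \<open>c \<le> \<epsilon> * a\<close>, one of the two terms alone dominates the product. The free
  weight \<epsilon> makes the first term absorbable, at the price of the factor
  \<open>\<epsilon> powr (1 - p)\<close> on the second.\<close>

lemma powr_mult_le:
  assumes "0 \<le> a" "0 \<le> c" "\<epsilon> > 0" "p > (1::real)"
  shows "a powr (p - 1) * c \<le> \<epsilon> * a powr p + \<epsilon> powr (1 - p) * c powr p"
proof (cases "c \<le> \<epsilon> * a")
  case True
  have "a powr (p - 1) * c \<le> a powr (p - 1) * (\<epsilon> * a)"
    using True by (intro mult_left_mono) auto
  also have "\<dots> = \<epsilon> * a powr p"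
    using assms by (cases "a = 0") (auto simp: powr_diff)
  finally show ?thesis using assms by (simp add: add_increasing2)
next
  case False
  then have "c > 0" using assms by (smt (verit) mult_nonneg_nonneg)
  have "a powr (p - 1) * c \<le> (c / \<epsilon>) powr (p - 1) * c"
    using assms False by (intro mult_right_mono powr_mono2) (auto simp: field_simps)
  also have "\<dots> = \<epsilon> powr (1 - p) * c powr p"
    using assms \<open>c > 0\<close> by (simp add: powr_divide powr_diff field_simps)
  finally show ?thesis using assms by (simp add: add_increasing)
qed

text \<open>At 0 the difference quotient has modulus \<open>\<bar>y\<bar> powr (p - 1)\<close>,
  which tends to 0 because \<open>p > 1\<close>. Since the p-th power of the modulus of a test
  function need not be smooth, the Poincare argument works with this first derivative and its
  continuity.\<close>

lemma has_real_derivative_abs_powr: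
  assumes "p > (1::real)"
  shows "((\<lambda>t. \<bar>t\<bar> powr p) has_real_derivative p * (sgn t * \<bar>t\<bar> powr (p - 1))) (at t)"
proof -
  consider "t < 0" | "t = 0" | "t > 0" by linarith
  then show ?thesis
  proof cases
    case 1
    have "((\<lambda>t. (- t) powr p) has_real_derivative - p * (- t) powr (p - 1)) (at t)"
      using 1 by (auto intro!: derivative_eq_intros)
    then have "((\<lambda>t. \<bar>t\<bar> powr p) has_real_derivative - p * (- t) powr (p - 1)) (at t)"
      by (rule has_field_derivative_transform_within_open[where S="{..<0}"]) (use 1 in auto)
    with 1 show ?thesis by simp
  next
    case 2
    have "((\<lambda>y::real. \<bar>y\<bar> powr (p - 1)) \<longlongrightarrow> \<bar>0\<bar> powr (p - 1)) (at 0)"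
      using assms by (intro tendsto_powr' tendsto_intros) auto
    then have "((\<lambda>y::real. \<bar>y\<bar> powr (p - 1)) \<longlongrightarrow> 0) (at 0)" using assms by simp
    then have "((\<lambda>y::real. norm (\<bar>y\<bar> powr p / y)) \<longlongrightarrow> 0) (at 0)"
    proof (rule Lim_transform_eventually)
      show "\<forall>\<^sub>F y in at 0. \<bar>y\<bar> powr (p - 1) = norm (\<bar>y\<bar> powr p / y)"
        by (auto simp: eventually_at_filter powr_diff)
    qed
    then have "((\<lambda>y. \<bar>y\<bar> powr p / y) \<longlongrightarrow> 0) (at 0)"
      by (rule tendsto_norm_zero_cancel)
    with 2 show ?thesis using assms by (simp add: has_field_derivative_iff)
  next
    case 3
    have "((\<lambda>t. t powr p) has_real_derivative p * t powr (p - 1)) (at t)"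
      using 3 by (auto intro!: derivative_eq_intros)
    then have "((\<lambda>t. \<bar>t\<bar> powr p) has_real_derivative p * t powr (p - 1)) (at t)"
      by (rule has_field_derivative_transform_within_open[where S="{0<..}"]) (use 3 in auto)
    with 3 show ?thesis by simp
  qed
qed

text \<open>Splitting into positive and negative parts removes the discontinuous factor
  \<open>sgn\<close>.\<close>

lemma continuous_on_sgn_abs_powr:
  assumes "q > (0::real)"
  shows "continuous_on A (\<lambda>t. sgn t * \<bar>t\<bar> powr q)"
proof -
  have "sgn t * \<bar>t\<bar> powr q = (max t 0) powr q - (max (- t) 0) powr q" for t
    using assms by (cases t "0::real" rule: linorder_cases) auto
  then show ?thesis
    using assms by (simp add: continuous_on_powr' continuous_intros)
qed

text \<open>
  The integral of the \<open>b\<close>-derivative of \<open>(x \<bullet> b) |\<phi>(x)|\<^sup>p\<close> vanishes; its first term is \<open>|\<phi>|\<^sup>p\<close> and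
  the second is absorbed by Young's inequality. No iterated integrals are needed.
\<close>

lemma Poincare_test_functions:
  fixes \<Omega> :: "'a::euclidean_space set"
  assumes "bounded \<Omega>" and p: "p > 1"
  obtains C where "C \<ge> 0"
    "\<And>\<phi>. \<phi> \<in> test_functions \<Omega> \<Longrightarrow>
       (LINT x:\<Omega>|lebesgue. \<bar>\<phi> x\<bar> powr p) \<le> C * (LINT x:\<Omega>|lebesgue. norm (gradient \<phi> x) powr p)"
proof -
  obtain R where R: "R > 0" "\<And>x. x \<in> \<Omega> \<Longrightarrow> norm x \<le> R"
    using \<open>bounded \<Omega>\<close> by (auto simp: bounded_pos)
  obtain b :: 'a where b: "b \<in> Basis" using nonempty_Basis by blast
  \<comment> \<open>Chosen so that \<open>p * R * \<epsilon> = 1 / 2\<close>: Young's inequality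
    then returns half of the p-th power of \<phi>, which is absorbed on the left. Clearing this half
    produces the factor 2 in \<open>C\<close>.\<close>
  define \<epsilon> where "\<epsilon> = 1 / (2 * (p * R))"
  have pR: "p * R > 0" using p R by simp
  then have "\<epsilon> > 0" by (simp add: \<epsilon>_def)
  define C where "C = 2 * (p * R * \<epsilon> powr (1 - p))"
  show ?thesis
  proof (rule that[of C])
    show "C \<ge> 0" using pR by (simp add: C_def)
    fix \<phi> assume \<phi>: "\<phi> \<in> test_functions \<Omega>"
    note s = smooth_on_UNIV_D[OF test_functionsD[OF \<phi>]]
    obtain K where K: "compact K" "K \<subseteq> \<Omega>" "\<And>x. x \<notin> K \<Longrightarrow> \<phi> x = 0"
      "\<And>x b. x \<notin> K \<Longrightarrow> partial_deriv \<phi> b x = 0" "\<And>x. x \<notin> K \<Longrightarrow> gradient \<phi> x = 0"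
      using test_function_support[OF \<phi>] by metis
    define D where "D x = \<bar>\<phi> x\<bar> powr p +
      (x \<bullet> b) * (p * (sgn (\<phi> x) * \<bar>\<phi> x\<bar> powr (p - 1)) * partial_deriv \<phi> b x)" for x
    have cpow: "continuous_on UNIV (\<lambda>x. \<bar>\<phi> x\<bar> powr p)" "continuous_on UNIV (\<lambda>x. norm (gradient \<phi> x) powr p)"
      by (rule continuous_on_powr'[OF _ continuous_on_const]; use p s in \<open>auto intro!: continuous_intros\<close>)+
    have csgn: "continuous_on UNIV (\<lambda>x. sgn (\<phi> x) * \<bar>\<phi> x\<bar> powr (p - 1))"
      using p by (intro continuous_on_compose2[OF continuous_on_sgn_abs_powr[of "p - 1" UNIV] s(2)]) auto
    have cD: "continuous_on UNIV D"
      unfolding D_def by (intro continuous_intros cpow csgn s b)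
    have D0: "(LINT x|lborel. D x) = 0"
    proof (rule integral_directional_derivative_eq_0[of "\<lambda>x. (x \<bullet> b) * \<bar>\<phi> x\<bar> powr p" b _ R])
      fix x
      have l: "((\<lambda>t. (x + t *\<^sub>R b) \<bullet> b) has_real_derivative 1) (at 0)"
        using b by (auto intro!: derivative_eq_intros simp: inner_add_left)
      have "((\<lambda>t. \<bar>\<phi> (x + t *\<^sub>R b)\<bar> powr p) has_real_derivative
          p * (sgn (\<phi> x) * \<bar>\<phi> x\<bar> powr (p - 1)) * partial_deriv \<phi> b x) (at 0)"
      proof -
        have "((\<lambda>t. \<phi> (x + t *\<^sub>R b)) has_real_derivative partial_deriv \<phi> b x) (at 0)"
          by (intro has_real_derivative_line s)
        from DERIV_chain2[OF has_real_derivative_abs_powr[OF p] this] show ?thesis by simp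
      qed
      from DERIV_mult[OF l this]
      show "((\<lambda>t. ((x + t *\<^sub>R b) \<bullet> b) * \<bar>\<phi> (x + t *\<^sub>R b)\<bar> powr p) has_real_derivative D x) (at 0)"
        by (simp add: D_def algebra_simps)
      show "(x \<bullet> b) * \<bar>\<phi> x\<bar> powr p = 0" if "R < norm x"
        using that R(2)[of x] K(2) K(3)[of x] by force
    qed (auto intro!: continuous_intros cpow cD)
    have intp: "integrable lborel (\<lambda>x. \<bar>\<phi> x\<bar> powr p)" "integrable lborel (\<lambda>x. norm (gradient \<phi> x) powr p)"
      "integrable lborel D"
      by (rule integrable_lborel_compact_support[OF _ K(1)]; use cpow cD K in \<open>auto simp: D_def\<close>)+
    \<comment> \<open>The bound keeps \<open>D\<close> explicit instead of estimating it, because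
      its integral is 0.\<close>
    have le: "\<bar>\<phi> x\<bar> powr p \<le> 2 * D x + C * norm (gradient \<phi> x) powr p" for x
    proof (cases "x \<in> K")
      case True
      let ?y = "\<bar>\<phi> x\<bar> powr (p - 1) * norm (gradient \<phi> x)"
      have "\<bar>x \<bullet> b\<bar> \<le> R"
        using Basis_le_norm[OF b, of x] R(2)[of x] True K by force
      moreover have "\<bar>partial_deriv \<phi> b x\<bar> \<le> norm (gradient \<phi> x)"
        using Basis_le_norm[OF b, of "gradient \<phi> x"] by (simp add: gradient_inner_Basis[OF b])
      ultimately have "\<bar>x \<bullet> b\<bar> * (p * (\<bar>sgn (\<phi> x)\<bar> * \<bar>\<phi> x\<bar> powr (p - 1)) * \<bar>partial_deriv \<phi> b x\<bar>)
          \<le> R * (p * (1 * \<bar>\<phi> x\<bar> powr (p - 1)) * norm (gradient \<phi> x))"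
        using R p by (intro mult_mono mult_nonneg_nonneg) (auto simp: abs_sgn_eq)
      then have "\<bar>(x \<bullet> b) * (p * (sgn (\<phi> x) * \<bar>\<phi> x\<bar> powr (p - 1)) * partial_deriv \<phi> b x)\<bar> \<le> p * R * ?y"
        using p by (simp add: abs_mult mult_ac)
      also have "\<dots> \<le> p * R * (\<epsilon> * \<bar>\<phi> x\<bar> powr p + \<epsilon> powr (1 - p) * norm (gradient \<phi> x) powr p)"
        using pR p \<open>\<epsilon> > 0\<close> by (intro mult_left_mono powr_mult_le) auto
      also have "\<dots> = \<bar>\<phi> x\<bar> powr p / 2 + C * norm (gradient \<phi> x) powr p / 2"
        using p R by (simp add: C_def \<epsilon>_def field_simps)
      finally show ?thesis unfolding D_def by (simp add: abs_le_iff)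
    qed (use K in \<open>auto simp: D_def\<close>)
    have "(LINT x|lborel. \<bar>\<phi> x\<bar> powr p) \<le> (LINT x|lborel. 2 * D x + C * norm (gradient \<phi> x) powr p)"
      by (intro integral_mono) (use intp le in auto)
    also have "\<dots> = C * (LINT x|lborel. norm (gradient \<phi> x) powr p)"
      using intp D0 by simp
    finally have *: "(LINT x|lborel. \<bar>\<phi> x\<bar> powr p) \<le> C * (LINT x|lborel. norm (gradient \<phi> x) powr p)" .
    have out: "\<phi> x = 0" "gradient \<phi> x = 0" if "x \<notin> \<Omega>" for x
      using that K(2,3,5) by blast+
    have "(LINT x:\<Omega>|lebesgue. \<bar>\<phi> x\<bar> powr p) = (LINT x|lborel. \<bar>\<phi> x\<bar> powr p)"
      "(LINT x:\<Omega>|lebesgue. norm (gradient \<phi> x) powr p) = (LINT x|lborel. norm (gradient \<phi> x) powr p)"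
      by (rule set_lebesgue_integral_eq_lborel; use cpow in \<open>simp add: out borel_measurable_continuous_onI\<close>)+
    with * show "(LINT x:\<Omega>|lebesgue. \<bar>\<phi> x\<bar> powr p) \<le> C * (LINT x:\<Omega>|lebesgue. norm (gradient \<phi> x) powr p)"
      by simp
  qed
qed

subsection \<open>Weak gradients\<close>

text \<open>Inner regularity: up to measure \<open>e\<close>, the set \<open>S\<close> is a closed
  subset, and that subset is a countable union of compact ones.\<close>

lemma null_sets_lebesgue_compactI:
  fixes S :: "'a::euclidean_space set"
  assumes S: "S \<in> sets lebesgue"
    and null: "\<And>T. compact T \<Longrightarrow> T \<subseteq> S \<Longrightarrow> T \<in> null_sets lebesgue"
  shows "S \<in> null_sets lebesgue"
proof -
  have "emeasure lebesgue S \<le> 0 + ennreal e" if "e > 0" for e :: real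
  proof -
    obtain T where T: "closed T" "T \<subseteq> S" "S - T \<in> lmeasurable" "emeasure lebesgue (S - T) < ennreal e"
      using sets_lebesgue_inner_closed[OF S \<open>e > 0\<close>] by blast
    have "(\<Union>n. T \<inter> cball 0 (real n)) \<in> null_sets lebesgue"
      using T by (intro null_sets_UN' null) (auto intro: closed_Int_compact)
    moreover have "(\<Union>n. T \<inter> cball 0 (real n)) = T"
      using real_arch_simple by (auto simp: mem_cball_0)
    ultimately have "T \<in> null_sets lebesgue" by simp
    then have "emeasure lebesgue (S - T) = emeasure lebesgue S"
      using S by (rule emeasure_Diff_null_set)
    with T(4) show ?thesis by simp
  qed
  then have "emeasure lebesgue S \<le> 0" using ennreal_le_epsilon[of 0 "emeasure lebesgue S"] by blast
  then show ?thesis using S by (auto simp: null_sets_def)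
qed

lemma set_integrable_mult_compact_support:
  fixes f \<phi> :: "'a::euclidean_space \<Rightarrow> real"
  assumes f: "f locally_integrable_on \<Omega>" and \<phi>: "continuous_on UNIV \<phi>"
    and K: "compact K" "K \<subseteq> \<Omega>" "\<And>x. x \<notin> K \<Longrightarrow> \<phi> x = 0"
  shows "set_integrable lebesgue \<Omega> (\<lambda>x. f x * \<phi> x)"
proof -
  have cK: "continuous_on K \<phi>" using \<phi> by (rule continuous_on_subset) simp
  have "(\<lambda>x. \<phi> x * f x) absolutely_integrable_on K"
  proof (rule absolutely_integrable_bounded_measurable_product[OF bilinear_times])
    show "\<phi> \<in> borel_measurable (lebesgue_on K)"
      using cK K(1) by (intro continuous_imp_measurable_on_sets_lebesgue lmeasurable_compact fmeasurableD)
    show "bounded (\<phi> ` K)"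
      using cK K(1) by (intro compact_imp_bounded compact_continuous_image)
    show "f absolutely_integrable_on K" using f K by (simp add: locally_integrable_on_def)
  qed (use K(1) in \<open>simp add: fmeasurableD lmeasurable_compact\<close>)
  moreover have "indicator \<Omega> x *\<^sub>R (f x * \<phi> x) = indicator K x *\<^sub>R (\<phi> x * f x)" for x
    using K(2,3) by (auto simp: indicator_def)
  ultimately show ?thesis by (simp only: set_integrable_def)
qed

lemma set_integrable_mult_test_function:
  fixes f :: "'a::euclidean_space \<Rightarrow> real"
  assumes f: "f locally_integrable_on \<Omega>" and \<phi>: "\<phi> \<in> test_functions \<Omega>"
  shows "set_integrable lebesgue \<Omega> (\<lambda>x. f x * \<phi> x)"
    and "b \<in> Basis \<Longrightarrow> set_integrable lebesgue \<Omega> (\<lambda>x. f x * partial_deriv \<phi> b x)"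
proof -
  obtain K where K: "compact K" "K \<subseteq> \<Omega>" "\<And>x. x \<notin> K \<Longrightarrow> \<phi> x = 0"
    "\<And>x b. x \<notin> K \<Longrightarrow> partial_deriv \<phi> b x = 0"
    using test_function_support[OF \<phi>] by metis
  note s = smooth_on_UNIV_D[OF test_functionsD[OF \<phi>]]
  show "set_integrable lebesgue \<Omega> (\<lambda>x. f x * \<phi> x)"
    using f s(2) K(1-3) by (rule set_integrable_mult_compact_support)
  show "set_integrable lebesgue \<Omega> (\<lambda>x. f x * partial_deriv \<phi> b x)" if "b \<in> Basis"
    using f s(3)[OF that] K(1,2,4) by (rule set_integrable_mult_compact_support)
qed

text \<open>Cutoffs around \<open>K\<close> with shrinking supports converge pointwise to the
  indicator of \<open>K\<close>. All of them live in one compact neighbourhood \<open>N\<close>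
  inside \<Omega>, on which \<open>f\<close> is integrable, so dominated convergence
  applies.\<close>

lemma integral_compact_eq_0_if_test_functions:
  fixes f :: "'a::euclidean_space \<Rightarrow> real"
  assumes \<Omega>: "open \<Omega>" and f: "f locally_integrable_on \<Omega>"
    and zero: "\<And>\<psi>. \<psi> \<in> test_functions \<Omega> \<Longrightarrow> (LINT x:\<Omega>|lebesgue. f x * \<psi> x) = 0"
    and K: "compact K" "K \<subseteq> \<Omega>"
  shows "(LINT x:K|lebesgue. f x) = 0"
proof -
  obtain \<epsilon> where \<epsilon>: "\<epsilon> > 0" "(\<Union>x\<in>K. cball x \<epsilon>) \<subseteq> \<Omega>"
    using compact_subset_open_imp_cball_epsilon_subset[OF K(1) \<Omega> K(2)] by blast
  \<comment> \<open>One null sequence controls both the deficit of the cutoff on \<open>K\<close>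
    and, scaled by \<epsilon>, the radius of its support around \<open>K\<close>.\<close>
  define d where "d n = inverse (real (Suc n))" for n
  have d: "d n > 0" "d n \<le> 1" for n by (auto simp: d_def inverse_le_1_iff)
  have d0: "d \<longlonglongrightarrow> 0" unfolding d_def[abs_def] by (rule LIMSEQ_inverse_real_of_nat)
  have de: "\<epsilon> * d n > 0" "\<epsilon> * d n \<le> \<epsilon>" for n using d[of n] \<epsilon>(1) by (auto simp: mult_left_le)
  have "\<exists>\<psi>\<in>test_functions \<Omega>. (\<forall>x. 0 \<le> \<psi> x) \<and> (\<forall>x. \<psi> x \<le> 1) \<and> (\<forall>x\<in>K. 1 - d n \<le> \<psi> x) \<and>
      (\<forall>x. x \<notin> (\<Union>y\<in>K. cball y (\<epsilon> * d n)) \<longrightarrow> \<psi> x = 0)" for n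
  proof -
    have "(\<Union>x\<in>K. cball x (\<epsilon> * d n)) \<subseteq> \<Omega>"
      using \<epsilon>(2) de(2)[of n] subset_cball[of "\<epsilon> * d n" \<epsilon>] by blast
    from test_function_near_indicator[OF K(1) de(1) this d(1)[of n]] show ?thesis by metis
  qed
  then obtain \<psi> where \<psi>: "\<And>n. \<psi> n \<in> test_functions \<Omega>" "\<And>n x. 0 \<le> \<psi> n x" "\<And>n x. \<psi> n x \<le> 1"
    "\<And>n x. x \<in> K \<Longrightarrow> 1 - d n \<le> \<psi> n x"
    "\<And>n x. x \<notin> (\<Union>y\<in>K. cball y (\<epsilon> * d n)) \<Longrightarrow> \<psi> n x = 0"
    by metis
  define N where "N = (\<Union>y\<in>K. cball y \<epsilon>)"
  have "compact N" unfolding N_def using K(1) by (rule compact_UN_cball)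
  then have intN: "set_integrable lebesgue N f"
    using f \<epsilon>(2) by (simp add: locally_integrable_on_def N_def)
  have psiN: "\<psi> n x = 0" if "x \<notin> N" for n x
    by (rule \<psi>(5)) (use that de(2)[of n] in \<open>auto simp: N_def\<close>)
  have lim: "(\<lambda>n. indicator \<Omega> x *\<^sub>R (f x * \<psi> n x)) \<longlonglongrightarrow> indicator K x *\<^sub>R f x" for x
  proof (cases "x \<in> K")
    case True
    have "(\<lambda>n. \<psi> n x) \<longlonglongrightarrow> 1"
    proof (rule tendsto_sandwich)
      show "(\<lambda>n. 1 - d n) \<longlonglongrightarrow> 1" using tendsto_diff[OF tendsto_const d0, of 1] by simp
    qed (use \<psi>(3,4) True in auto)
    then have "(\<lambda>n. indicator \<Omega> x *\<^sub>R (f x * \<psi> n x)) \<longlonglongrightarrow> indicator \<Omega> x *\<^sub>R (f x * 1)"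
      by (intro tendsto_intros)
    then show ?thesis using True K(2) by auto
  next
    case False
    then obtain e where e: "e > 0" "ball x e \<subseteq> - K"
      using K(1) by (metis ComplI compact_imp_closed open_Compl openE)
    have "(\<lambda>n. \<epsilon> * d n) \<longlonglongrightarrow> 0" using tendsto_mult_left[OF d0, of \<epsilon>] by simp
    then have "\<forall>\<^sub>F n in sequentially. \<epsilon> * d n < e"
      using e(1) order_tendstoD(2) by blast
    then have "\<forall>\<^sub>F n in sequentially. indicator \<Omega> x *\<^sub>R (f x * \<psi> n x) = 0"
    proof (rule eventually_mono)
      fix n assume n: "\<epsilon> * d n < e"
      have "x \<notin> (\<Union>y\<in>K. cball y (\<epsilon> * d n))"
      proof
        assume "x \<in> (\<Union>y\<in>K. cball y (\<epsilon> * d n))"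
        then obtain y where "y \<in> K" "dist y x \<le> \<epsilon> * d n" by auto
        then have "y \<in> ball x e" using n by (simp add: dist_commute)
        with \<open>y \<in> K\<close> e show False by blast
      qed
      then show "indicator \<Omega> x *\<^sub>R (f x * \<psi> n x) = 0" using \<psi>(5) by simp
    qed
    then show ?thesis using False by (simp add: tendsto_eventually)
  qed
  have int: "integrable lebesgue (\<lambda>x. indicator \<Omega> x *\<^sub>R (f x * \<psi> n x))" for n
    using set_integrable_mult_test_function(1)[OF f \<psi>(1)] by (simp add: set_integrable_def)
  have "(\<lambda>n. LINT x|lebesgue. indicator \<Omega> x *\<^sub>R (f x * \<psi> n x)) \<longlonglongrightarrow> (LINT x|lebesgue. indicator K x *\<^sub>R f x)"
  proof (rule integral_dominated_convergence)
    show "integrable lebesgue (\<lambda>x. norm (indicator N x *\<^sub>R f x))"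
      using intN by (intro integrable_norm) (simp add: set_integrable_def)
    show "(\<lambda>x. indicator \<Omega> x *\<^sub>R (f x * \<psi> n x)) \<in> borel_measurable lebesgue" for n
      using int by (rule borel_measurable_integrable)
    have "set_integrable lebesgue K f" using f K by (simp add: locally_integrable_on_def)
    then show "(\<lambda>x. indicator K x *\<^sub>R f x) \<in> borel_measurable lebesgue"
      unfolding set_integrable_def by (rule borel_measurable_integrable)
    show "AE x in lebesgue. norm (indicator \<Omega> x *\<^sub>R (f x * \<psi> n x)) \<le> norm (indicator N x *\<^sub>R f x)" for n
    proof (rule AE_I2)
      fix x
      have "\<bar>f x\<bar> * \<psi> n x \<le> \<bar>f x\<bar> * 1" using \<psi>(3) by (intro mult_left_mono) auto
      then show "norm (indicator \<Omega> x *\<^sub>R (f x * \<psi> n x)) \<le> norm (indicator N x *\<^sub>R f x)"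
        using psiN[of x n] \<psi>(2)[of n x] by (auto simp: indicator_def abs_mult)
    qed
  qed (use lim in auto)
  moreover have "(LINT x|lebesgue. indicator \<Omega> x *\<^sub>R (f x * \<psi> n x)) = 0" for n
    using zero[OF \<psi>(1)] by (simp add: set_lebesgue_integral_def)
  ultimately show ?thesis by (simp add: set_lebesgue_integral_def LIMSEQ_const_iff)
qed

text \<open>On a compact subset of the set where \<open>f > 0\<close>, the integral of
  \<open>f\<close> vanishes although \<open>f\<close> is positive, so the subset is null. Local
  integrability gives measurability only on compact sets, hence the exhaustion of \<Omega> by the
  sets \<open>C n\<close>.\<close>

lemma AE_nonpos_if_test_functions:
  fixes f :: "'a::euclidean_space \<Rightarrow> real"
  assumes \<Omega>: "open \<Omega>" and f: "f locally_integrable_on \<Omega>"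
    and zero: "\<And>\<psi>. \<psi> \<in> test_functions \<Omega> \<Longrightarrow> (LINT x:\<Omega>|lebesgue. f x * \<psi> x) = 0"
  shows "AE x in lebesgue. x \<in> \<Omega> \<longrightarrow> f x \<le> 0"
proof -
  obtain C where C: "\<And>n::nat. compact (C n)" "\<And>n. C n \<subseteq> \<Omega>" "\<Union>(range C) = \<Omega>"
  proof (rule open_Union_compact_subsets[OF \<Omega>])
    fix C :: "nat \<Rightarrow> 'a set"
    assume "\<And>n. compact (C n)" "\<And>n. C n \<subseteq> \<Omega>" "\<Union>(range C) = \<Omega>"
    then show thesis by (rule that)
  qed
  have "{x \<in> C n. f x > 0} \<in> null_sets lebesgue" for n :: nat
  proof (rule null_sets_lebesgue_compactI)
    have "set_integrable lebesgue (C n) f"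
      using f C(1,2) by (simp add: locally_integrable_on_def)
    then have [measurable]: "(\<lambda>x. indicator (C n) x *\<^sub>R f x) \<in> borel_measurable lebesgue"
      unfolding set_integrable_def by (rule borel_measurable_integrable)
    have "{x \<in> C n. f x > 0} = {x \<in> space lebesgue. indicator (C n) x *\<^sub>R f x > 0}"
      by (auto simp: indicator_def)
    also have "\<dots> \<in> sets lebesgue" by measurable
    finally show "{x \<in> C n. f x > 0} \<in> sets lebesgue" .
  next
    fix T assume T: "compact T" "T \<subseteq> {x \<in> C n. f x > 0}"
    then have "T \<subseteq> \<Omega>" using C(2) by blast
    then have "(LINT x:T|lebesgue. f x) = 0" and int: "set_integrable lebesgue T f"
      using integral_compact_eq_0_if_test_functions[OF \<Omega> f zero T(1)] f T(1)
      by (auto simp: locally_integrable_on_def)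
    moreover have "0 \<le> indicator T x *\<^sub>R f x" for x
      using T(2) by (auto simp: indicator_def)
    ultimately have "AE x in lebesgue. indicator T x *\<^sub>R f x = 0"
      by (subst (asm) set_lebesgue_integral_def, subst integral_nonneg_eq_0_iff_AE[symmetric])
         (auto simp: set_integrable_def)
    then have "AE x in lebesgue. x \<notin> T"
      by (rule AE_mp) (use T(2) in \<open>auto intro!: AE_I2\<close>)
    then show "T \<in> null_sets lebesgue"
      using T(1) by (subst AE_iff_null_sets) (auto intro: fmeasurableD lmeasurable_compact)
  qed
  then have "AE x in lebesgue. \<forall>n. x \<notin> {x \<in> C n. f x > 0}"
    unfolding AE_all_countable by (intro allI AE_not_in)
  then show ?thesis by (rule AE_mp) (use C(3) in \<open>auto intro!: AE_I2 simp: not_less\<close>)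
qed

text \<open>The fundamental lemma of the calculus of variations, obtained from the one-sided version
  for \<open>f\<close> and \<open>- f\<close>.\<close>

lemma AE_zero_if_test_functions:
  fixes f :: "'a::euclidean_space \<Rightarrow> real"
  assumes \<Omega>: "open \<Omega>" and f: "f locally_integrable_on \<Omega>"
    and zero: "\<And>\<psi>. \<psi> \<in> test_functions \<Omega> \<Longrightarrow> (LINT x:\<Omega>|lebesgue. f x * \<psi> x) = 0"
  shows "AE x in lebesgue. x \<in> \<Omega> \<longrightarrow> f x = 0"
proof -
  have "AE x in lebesgue. x \<in> \<Omega> \<longrightarrow> f x \<le> 0"
    using assms by (rule AE_nonpos_if_test_functions)
  moreover have "AE x in lebesgue. x \<in> \<Omega> \<longrightarrow> - f x \<le> 0"
  proof (rule AE_nonpos_if_test_functions[OF \<Omega>])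
    show "(\<lambda>x. - f x) locally_integrable_on \<Omega>"
      using f by (simp add: locally_integrable_on_def set_integrable_def)
    show "(LINT x:\<Omega>|lebesgue. - f x * \<psi> x) = 0" if "\<psi> \<in> test_functions \<Omega>" for \<psi>
      using zero[OF that] by (simp add: set_lebesgue_integral_def)
  qed
  ultimately show ?thesis by eventually_elim auto
qed

section \<open>Uniqueness and linearity of weak gradients\<close>

lemma locally_integrable_on_add:
  "f locally_integrable_on \<Omega> \<Longrightarrow> g locally_integrable_on \<Omega> \<Longrightarrow> (\<lambda>x. f x + g x) locally_integrable_on \<Omega>"
  by (simp add: locally_integrable_on_def set_integral_add)

lemma locally_integrable_on_diff:
  "f locally_integrable_on \<Omega> \<Longrightarrow> g locally_integrable_on \<Omega> \<Longrightarrow> (\<lambda>x. f x - g x) locally_integrable_on \<Omega>"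
  by (simp add: locally_integrable_on_def set_integral_diff)

lemma locally_integrable_on_inner:
  assumes "f locally_integrable_on \<Omega>"
  shows "(\<lambda>x. f x \<bullet> b) locally_integrable_on \<Omega>"
proof -
  have "integrable lebesgue (\<lambda>x. (indicator K x *\<^sub>R f x) \<bullet> b)" if "compact K" "K \<subseteq> \<Omega>" for K
    by (intro integrable_inner_left) (use assms that in \<open>auto simp: locally_integrable_on_def set_integrable_def\<close>)
  then show ?thesis by (simp add: locally_integrable_on_def set_integrable_def)
qed

lemma weak_gradient_unique:
  fixes g g' :: "'a::euclidean_space \<Rightarrow> 'a"
  assumes \<Omega>: "open \<Omega>" and g: "has_weak_gradient u g \<Omega>" and g': "has_weak_gradient u g' \<Omega>"
  shows "AE x in lebesgue. x \<in> \<Omega> \<longrightarrow> g x = g' x"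
proof -
  have "AE x in lebesgue. x \<in> \<Omega> \<longrightarrow> g x \<bullet> b - g' x \<bullet> b = 0" if b: "b \<in> Basis" for b
  proof (rule AE_zero_if_test_functions[OF \<Omega>])
    have l: "(\<lambda>x. g x \<bullet> b) locally_integrable_on \<Omega>" "(\<lambda>x. g' x \<bullet> b) locally_integrable_on \<Omega>"
      using g g' by (auto simp: has_weak_gradient_def intro: locally_integrable_on_inner)
    then show "(\<lambda>x. g x \<bullet> b - g' x \<bullet> b) locally_integrable_on \<Omega>"
      by (rule locally_integrable_on_diff)
    fix \<psi> assume \<psi>: "\<psi> \<in> test_functions \<Omega>"
    have "- (LINT x:\<Omega>|lebesgue. (g x \<bullet> b) * \<psi> x) = - (LINT x:\<Omega>|lebesgue. (g' x \<bullet> b) * \<psi> x)"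
      using g g' \<psi> b unfolding has_weak_gradient_def by simp
    then show "(LINT x:\<Omega>|lebesgue. (g x \<bullet> b - g' x \<bullet> b) * \<psi> x) = 0"
      using l[THEN set_integrable_mult_test_function(1), OF \<psi>]
      by (simp add: left_diff_distrib set_integral_diff)
  qed
  then have "AE x in lebesgue. \<forall>b\<in>Basis. x \<in> \<Omega> \<longrightarrow> g x \<bullet> b - g' x \<bullet> b = 0"
    by (intro AE_finite_allI finite_Basis)
  then show ?thesis by eventually_elim (auto intro: euclidean_eqI)
qed

text \<open>Allows the value of the choice operator to be replaced under integrals by any explicit
  weak gradient.\<close>

lemma weak_gradient_AE_eq:
  assumes "open \<Omega>" and "has_weak_gradient u g \<Omega>"
  shows "AE x in lebesgue_on \<Omega>. weak_gradient \<Omega> u x = g x"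
proof -
  have "has_weak_gradient u (weak_gradient \<Omega> u) \<Omega>"
    unfolding weak_gradient_def by (rule someI[of "\<lambda>g. has_weak_gradient u g \<Omega>", OF assms(2)])
  from weak_gradient_unique[OF assms(1) this assms(2)] show ?thesis
    using assms(1) by (subst AE_restrict_space_iff) auto
qed

lemma has_weak_gradient_add:
  assumes u: "has_weak_gradient u g \<Omega>" and v: "has_weak_gradient v h \<Omega>"
  shows "has_weak_gradient (\<lambda>x. u x + v x) (\<lambda>x. g x + h x) \<Omega>"
proof -
  have l: "u locally_integrable_on \<Omega>" "v locally_integrable_on \<Omega>" "g locally_integrable_on \<Omega>" "h locally_integrable_on \<Omega>"
    using u v by (auto simp: has_weak_gradient_def)
  have "(LINT x:\<Omega>|lebesgue. (u x + v x) * partial_deriv \<phi> b x) = - (LINT x:\<Omega>|lebesgue. ((g x + h x) \<bullet> b) * \<phi> x)"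
    if \<phi>: "\<phi> \<in> test_functions \<Omega>" and b: "b \<in> Basis" for \<phi> b
    using l(1,2)[THEN set_integrable_mult_test_function(2), OF \<phi> b]
      l(3,4)[THEN locally_integrable_on_inner, THEN set_integrable_mult_test_function(1), OF \<phi>, of b] u v \<phi> b
    by (simp add: distrib_right inner_add_left set_integral_add has_weak_gradient_def)
  then show ?thesis using l by (simp add: has_weak_gradient_def locally_integrable_on_add)
qed

lemma has_weak_gradient_diff:
  assumes u: "has_weak_gradient u g \<Omega>" and v: "has_weak_gradient v h \<Omega>"
  shows "has_weak_gradient (\<lambda>x. u x - v x) (\<lambda>x. g x - h x) \<Omega>"
proof -
  have l: "u locally_integrable_on \<Omega>" "v locally_integrable_on \<Omega>" "g locally_integrable_on \<Omega>" "h locally_integrable_on \<Omega>"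
    using u v by (auto simp: has_weak_gradient_def)
  have "(LINT x:\<Omega>|lebesgue. (u x - v x) * partial_deriv \<phi> b x) = - (LINT x:\<Omega>|lebesgue. ((g x - h x) \<bullet> b) * \<phi> x)"
    if \<phi>: "\<phi> \<in> test_functions \<Omega>" and b: "b \<in> Basis" for \<phi> b
    using l(1,2)[THEN set_integrable_mult_test_function(2), OF \<phi> b]
      l(3,4)[THEN locally_integrable_on_inner, THEN set_integrable_mult_test_function(1), OF \<phi>, of b] u v \<phi> b
    by (simp add: left_diff_distrib inner_diff_left set_integral_diff has_weak_gradient_def)
  then show ?thesis using l by (simp add: has_weak_gradient_def locally_integrable_on_diff)
qed

lemma has_weak_gradient_AE_0:
  assumes "u locally_integrable_on \<Omega>" and "AE x in lebesgue. x \<in> \<Omega> \<longrightarrow> u x = 0"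
  shows "has_weak_gradient u (\<lambda>_. 0) \<Omega>"
proof -
  have "(LINT x:\<Omega>|lebesgue. u x * partial_deriv \<phi> b x) = 0" for \<phi> b
    unfolding set_lebesgue_integral_def
    by (rule integral_eq_zero_AE) (use assms(2) in \<open>eventually_elim, auto simp: indicator_def\<close>)
  then show ?thesis
    using assms(1) by (simp add: has_weak_gradient_def locally_integrable_on_def set_integrable_def set_lebesgue_integral_def)
qed

subsection \<open>Convexity of the energy density\<close>

lemma powr_tangent_less:
  assumes "0 \<le> r" "r \<noteq> 1" "1 < (p::real)"
  shows "1 + p * (r - 1) < r powr p"
proof (cases "r = 0")
  case True
  then show ?thesis using assms by simp
next
  case False
  then have "r > 0" using assms by simp
  have der: "((\<lambda>x. x powr p) has_real_derivative p * x powr (p - 1)) (at x)" if "x > 0" for x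
    using that by (auto intro!: derivative_eq_intros)
  show ?thesis
  proof (cases "r > 1")
    case True
    obtain z where z: "1 < z" "z < r" "r powr p - 1 powr p = (r - 1) * (p * z powr (p - 1))"
      using MVT2[OF True, of "\<lambda>x. x powr p" "\<lambda>x. p * x powr (p - 1)"] der by force
    have "1 < z powr (p - 1)"
      using assms z by (intro gr_one_powr) auto
    then have "(r - 1) * (p * 1) < (r - 1) * (p * z powr (p - 1))"
      using True assms by (intro mult_strict_left_mono) auto
    then show ?thesis using z by (simp add: algebra_simps)
  next
    case False
    then have "r < 1" using assms by simp
    obtain z where z: "r < z" "z < 1" "1 powr p - r powr p = (1 - r) * (p * z powr (p - 1))"
      using MVT2[OF \<open>r < 1\<close>, of "\<lambda>x. x powr p" "\<lambda>x. p * x powr (p - 1)"] der \<open>r > 0\<close> by force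
    have "z powr (p - 1) < 1 powr (p - 1)"
      using assms z \<open>r > 0\<close> by (intro powr_less_mono2) auto
    then have "(1 - r) * (p * z powr (p - 1)) < (1 - r) * (p * 1)"
      using \<open>r < 1\<close> assms by (intro mult_strict_left_mono) auto
    then show ?thesis using z by (simp add: algebra_simps)
  qed
qed

text \<open>Put \<open>s = norm a\<close> and \<open>t = norm (a + d)\<close>. Cauchy-Schwarz gives
  \<open>a \<bullet> d \<le> s * t - s^2\<close>, which reduces the claim to the scalar tangent
  inequality at \<open>t / s\<close>.\<close>

lemma norm_powr_tangent:
  fixes a d :: "'a::real_inner"
  assumes p: "1 < p"
  shows "norm a powr p + p * ((norm a powr (p - 2) *\<^sub>R a) \<bullet> d) \<le> norm (a + d) powr p"
    and "d \<noteq> 0 \<Longrightarrow> norm a powr p + p * ((norm a powr (p - 2) *\<^sub>R a) \<bullet> d) < norm (a + d) powr p"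
proof -
  show strict: "norm a powr p + p * ((norm a powr (p - 2) *\<^sub>R a) \<bullet> d) < norm (a + d) powr p" if d: "d \<noteq> 0"
  proof (cases "a = 0")
    \<comment> \<open>Here the linear term is 0 for every \<open>p\<close>, and the claim is just
      positivity of \<open>norm d powr p\<close>.\<close>
    case True
    then show ?thesis using d by simp
  next
    case False
    define s where "s = norm a"
    define t where "t = norm (a + d)"
    have s: "s > 0" using False by (simp add: s_def)
    have t: "t \<ge> 0" by (simp add: t_def)
    have ad: "s\<^sup>2 + a \<bullet> d = a \<bullet> (a + d)" by (simp add: s_def power2_norm_eq_inner inner_add_right)
    have le: "s\<^sup>2 + a \<bullet> d \<le> s * t"
      by (metis ad s_def t_def norm_cauchy_schwarz)
    have pw: "s powr p = s powr (p - 2) * s\<^sup>2"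
      using s by (simp add: powr_diff)
    have tp: "t powr p = s powr p * (t / s) powr p"
      using s t by (simp add: powr_divide)
    have "s powr p + p * (s powr (p - 2) * (a \<bullet> d)) < t powr p"
    proof (cases "t = s")
      \<comment> \<open>The scalar inequality is an equality at ratio 1. Strictness comes instead
        from the direction: equal norms and \<open>d \<noteq> 0\<close> force
        \<open>a \<bullet> d < 0\<close>.\<close>
      case True
      have "t\<^sup>2 = s\<^sup>2 + 2 * (a \<bullet> d) + d \<bullet> d"
        by (simp add: s_def t_def power2_norm_eq_inner inner_add_left inner_add_right inner_commute)
      then have "2 * (a \<bullet> d) + d \<bullet> d = 0" using True by simp
      moreover have "d \<bullet> d > 0" using d by simp
      ultimately have "a \<bullet> d < 0" by linarith
      then have "p * (s powr (p - 2) * (a \<bullet> d)) < 0"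
        using p s by (simp add: mult_pos_neg)
      then show ?thesis using True by simp
    next
      case False
      have "s powr p + p * (s powr (p - 2) * (a \<bullet> d)) \<le> s powr p + p * (s powr (p - 2) * (s * t - s\<^sup>2))"
        using le p by (intro add_left_mono mult_left_mono) auto
      also have "\<dots> = s powr p * (1 + p * (t / s - 1))"
        unfolding pw using s by (simp add: field_simps power2_eq_square)
      also have "\<dots> < s powr p * (t / s) powr p"
        using s t p False by (intro mult_strict_left_mono powr_tangent_less) auto
      finally show ?thesis using tp by simp
    qed
    then show ?thesis by (simp add: s_def t_def)
  qed
  show "norm a powr p + p * ((norm a powr (p - 2) *\<^sub>R a) \<bullet> d) \<le> norm (a + d) powr p"
    using strict by (cases "d = 0") auto
qed

lemma norm_add_powr_le:
  fixes a b :: "'a::real_normed_vector"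
  assumes "0 < p"
  shows "norm (a + b) powr p \<le> 2 powr p * (norm a powr p + norm b powr p)"
proof -
  have "norm (a + b) powr p \<le> (2 * max (norm a) (norm b)) powr p"
    using norm_triangle_ineq[of a b] assms by (intro powr_mono2) auto
  also have "\<dots> = 2 powr p * max (norm a) (norm b) powr p" by (simp add: powr_mult)
  also have "\<dots> \<le> 2 powr p * (norm a powr p + norm b powr p)"
    by (intro mult_left_mono) (auto simp: max_def)
  finally show ?thesis .
qed

subsection \<open>Minimality of p-harmonic functions\<close>

lemma set_lebesgue_integral_eq_lebesgue_on:
  fixes f :: "'a::euclidean_space \<Rightarrow> 'b::euclidean_space"
  assumes "\<Omega> \<in> sets lebesgue"
  shows "(LINT x:\<Omega>|lebesgue. f x) = (LINT x|lebesgue_on \<Omega>. f x)"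
  using assms by (simp add: set_lebesgue_integral_def integral_restrict_space)

lemma Lp_space_iff:
  assumes "\<Omega> \<in> sets lebesgue"
  shows "f \<in> Lp_space p \<Omega> \<longleftrightarrow>
    f \<in> borel_measurable (lebesgue_on \<Omega>) \<and> integrable (lebesgue_on \<Omega>) (\<lambda>x. norm (f x) powr p)"
  using assms by (simp add: Lp_space_def set_integrable_def integrable_restrict_space)

lemma Lp_space_add:
  assumes \<Omega>: "\<Omega> \<in> sets lebesgue" and p: "0 < p" and f: "f \<in> Lp_space p \<Omega>" and g: "g \<in> Lp_space p \<Omega>"
  shows "(\<lambda>x. f x + g x) \<in> Lp_space p \<Omega>"
proof -
  note * = f[unfolded Lp_space_iff[OF \<Omega>]] g[unfolded Lp_space_iff[OF \<Omega>]]
  have [measurable]: "f \<in> borel_measurable (lebesgue_on \<Omega>)" "g \<in> borel_measurable (lebesgue_on \<Omega>)"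
    using * by auto
  have "integrable (lebesgue_on \<Omega>) (\<lambda>x. norm (f x + g x) powr p)"
  proof (rule Bochner_Integration.integrable_bound)
    show "integrable (lebesgue_on \<Omega>) (\<lambda>x. 2 powr p * (norm (f x) powr p + norm (g x) powr p))"
      using * by auto
  qed (use norm_add_powr_le[OF p] in \<open>auto intro!: AE_I2\<close>)
  then show ?thesis by (simp add: Lp_space_iff[OF \<Omega>])
qed

lemma Lp_space_diff:
  assumes "\<Omega> \<in> sets lebesgue" "0 < p" "f \<in> Lp_space p \<Omega>" "g \<in> Lp_space p \<Omega>"
  shows "(\<lambda>x. f x - g x) \<in> Lp_space p \<Omega>"
proof -
  have "(\<lambda>x. - g x) \<in> Lp_space p \<Omega>"
    using assms(4) by (simp add: Lp_space_iff[OF assms(1)])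
  from Lp_space_add[OF assms(1,2,3) this] show ?thesis by simp
qed

lemma Lp_space_compact_support:
  fixes F :: "'a::euclidean_space \<Rightarrow> 'b::euclidean_space"
  assumes \<Omega>: "\<Omega> \<in> sets lebesgue" and p: "0 < p" and F: "continuous_on UNIV F"
    and K: "compact K" "\<And>x. x \<notin> K \<Longrightarrow> F x = 0"
  shows "F \<in> Lp_space p \<Omega>"
proof -
  have c: "continuous_on UNIV (\<lambda>x. norm (F x) powr p)"
    by (rule continuous_on_powr'[OF _ continuous_on_const]) (use p F in \<open>auto intro!: continuous_intros\<close>)
  have "integrable lborel (\<lambda>x. norm (F x) powr p)"
    by (rule integrable_lborel_compact_support[OF c K(1)]) (simp add: K(2))
  then have "integrable lebesgue (\<lambda>x. norm (F x) powr p)"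
    using integrable_completion borel_measurable_integrable by blast
  then have "integrable lebesgue (\<lambda>x. indicator \<Omega> x *\<^sub>R norm (F x) powr p)"
    by (rule integrable_mult_indicator[OF \<Omega>])
  then have "integrable (lebesgue_on \<Omega>) (\<lambda>x. norm (F x) powr p)"
    using \<Omega> by (simp add: integrable_restrict_space)
  moreover have "F \<in> borel_measurable (lebesgue_on \<Omega>)"
    using \<Omega> F by (intro continuous_imp_measurable_on_sets_lebesgue) (auto intro: continuous_on_subset)
  ultimately show ?thesis by (simp add: Lp_space_iff[OF \<Omega>])
qed

lemma Lp_space_test_function:
  assumes "\<Omega> \<in> sets lebesgue" "0 < p" and \<phi>: "\<phi> \<in> test_functions \<Omega>"
  shows "\<phi> \<in> Lp_space p \<Omega>" "gradient \<phi> \<in> Lp_space p \<Omega>"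
proof -
  obtain K where K: "compact K" "\<And>x. x \<notin> K \<Longrightarrow> \<phi> x = 0" "\<And>x. x \<notin> K \<Longrightarrow> gradient \<phi> x = 0"
    using test_function_support[OF \<phi>] by metis
  note s = smooth_on_UNIV_D[OF test_functionsD[OF \<phi>]]
  show "\<phi> \<in> Lp_space p \<Omega>"
    using assms(1,2) s(2) K(1,2) by (rule Lp_space_compact_support)
  show "gradient \<phi> \<in> Lp_space p \<Omega>"
    using assms(1,2) s(4) K(1,3) by (rule Lp_space_compact_support)
qed

text \<open>Completeness of Lebesgue measure. The chosen weak gradient is controlled only up to null
  sets, so its measurability has to be inherited in this way.\<close>

lemma borel_measurable_lebesgue_on_AE:
  fixes f g :: "'a::euclidean_space \<Rightarrow> 'b::euclidean_space"
  assumes \<Omega>: "\<Omega> \<in> sets lebesgue" and f: "f \<in> borel_measurable (lebesgue_on \<Omega>)"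
    and ae: "AE x in lebesgue_on \<Omega>. f x = g x"
  shows "g \<in> borel_measurable (lebesgue_on \<Omega>)"
proof -
  have "(\<lambda>x. indicator \<Omega> x *\<^sub>R f x) \<in> borel_measurable lebesgue"
    using f \<Omega> by (simp add: borel_measurable_restrict_space_iff)
  moreover have "AE x in lebesgue. indicator \<Omega> x *\<^sub>R f x = indicator \<Omega> x *\<^sub>R g x"
    using ae \<Omega> by (subst (asm) AE_restrict_space_iff) (auto simp: indicator_def elim: eventually_mono)
  ultimately have "(\<lambda>x. indicator \<Omega> x *\<^sub>R g x) \<in> borel_measurable lebesgue"
    by (rule borel_measurable_AE)
  then show ?thesis using \<Omega> by (simp add: borel_measurable_restrict_space_iff)
qed

lemma Lp_space_cong_AE:
  fixes f g :: "'a::euclidean_space \<Rightarrow> 'b::euclidean_space"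
  assumes \<Omega>: "\<Omega> \<in> sets lebesgue" and f: "f \<in> Lp_space p \<Omega>"
    and ae: "AE x in lebesgue_on \<Omega>. f x = g x"
  shows "g \<in> Lp_space p \<Omega>"
proof -
  note * = f[unfolded Lp_space_iff[OF \<Omega>]]
  have [measurable]: "g \<in> borel_measurable (lebesgue_on \<Omega>)"
    using borel_measurable_lebesgue_on_AE[OF \<Omega> _ ae] * by blast
  have "integrable (lebesgue_on \<Omega>) (\<lambda>x. norm (g x) powr p)"
  proof (rule integrable_cong_AE_imp)
    show "integrable (lebesgue_on \<Omega>) (\<lambda>x. norm (f x) powr p)" using * by blast
    show "AE x in lebesgue_on \<Omega>. norm (f x) powr p = norm (g x) powr p" using ae by eventually_elim simp
  qed measurable
  then show ?thesis by (simp add: Lp_space_iff[OF \<Omega>])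
qed

text \<open>Membership in \<open>W1p\<close> supplies some weak gradient in L^p, possibly not the
  chosen one; uniqueness up to null sets transfers the integrability.\<close>

lemma weak_gradient_W1p:
  assumes \<Omega>: "open \<Omega>" and u: "u \<in> W1p p \<Omega>"
  shows "has_weak_gradient u (weak_gradient \<Omega> u) \<Omega>" "weak_gradient \<Omega> u \<in> Lp_space p \<Omega>"
proof -
  obtain g where g: "has_weak_gradient u g \<Omega>" "g \<in> Lp_space p \<Omega>"
    using u by (auto simp: W1p_def)
  show "has_weak_gradient u (weak_gradient \<Omega> u) \<Omega>"
    unfolding weak_gradient_def by (rule someI[of "\<lambda>g. has_weak_gradient u g \<Omega>", OF g(1)])
  have ae: "AE x in lebesgue_on \<Omega>. g x = weak_gradient \<Omega> u x"
    using weak_gradient_AE_eq[OF \<Omega> g(1)] by eventually_elim simp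
  show "weak_gradient \<Omega> u \<in> Lp_space p \<Omega>"
    by (rule Lp_space_cong_AE[OF _ g(2) ae]) (use \<Omega> in simp)
qed

lemma p_energy_eq:
  assumes \<Omega>: "open \<Omega>" and g: "has_weak_gradient u g \<Omega>" "g \<in> Lp_space p \<Omega>"
  shows "p_energy p u \<Omega> = (LINT x|lebesgue_on \<Omega>. norm (g x) powr p)"
proof -
  have [simp]: "\<Omega> \<in> sets lebesgue" using \<Omega> by simp
  have ae: "AE x in lebesgue_on \<Omega>. weak_gradient \<Omega> u x = g x"
    by (rule weak_gradient_AE_eq[OF \<Omega> g(1)])
  have gm [measurable]: "g \<in> borel_measurable (lebesgue_on \<Omega>)"
    using g(2) by (simp add: Lp_space_iff)
  have [measurable]: "weak_gradient \<Omega> u \<in> borel_measurable (lebesgue_on \<Omega>)"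
    by (rule borel_measurable_lebesgue_on_AE[OF _ gm]) (use ae in \<open>auto elim: eventually_mono\<close>)
  have "(LINT x|lebesgue_on \<Omega>. norm (weak_gradient \<Omega> u x) powr p) = (LINT x|lebesgue_on \<Omega>. norm (g x) powr p)"
    by (rule integral_cong_AE) (measurable, use ae in \<open>auto elim: eventually_mono\<close>)
  then show ?thesis by (simp add: p_energy_def set_lebesgue_integral_eq_lebesgue_on)
qed

text \<open>The Sobolev norm of \<open>v - \<phi>\<close> is \<open>(A + B) powr (1 / p)\<close>
  with \<open>A\<close> and \<open>B\<close> nonnegative, so the threshold
  \<open>\<eta> powr (1 / p)\<close> bounds each of the two integrals by \<eta>.\<close>

lemma W1p_0_approx:
  assumes \<Omega>: "open \<Omega>" and p: "1 < p" and v: "v \<in> W1p_0 p \<Omega>" and "0 < \<eta>"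
  obtains \<phi> where "\<phi> \<in> test_functions \<Omega>"
    "(LINT x|lebesgue_on \<Omega>. \<bar>v x - \<phi> x\<bar> powr p) < \<eta>"
    "(LINT x|lebesgue_on \<Omega>. norm (weak_gradient \<Omega> v x - gradient \<phi> x) powr p) < \<eta>"
proof -
  have [simp]: "\<Omega> \<in> sets lebesgue" using \<Omega> by simp
  have v1: "v \<in> W1p p \<Omega>" using v by (simp add: W1p_0_def)
  obtain \<phi> where \<phi>: "\<phi> \<in> test_functions \<Omega>" "W1p_norm p \<Omega> (\<lambda>x. v x - \<phi> x) < \<eta> powr (1 / p)"
    using v \<open>0 < \<eta>\<close> unfolding W1p_0_def by (auto dest!: spec[of _ "\<eta> powr (1 / p)"])
  define A where "A = (LINT x|lebesgue_on \<Omega>. \<bar>v x - \<phi> x\<bar> powr p)"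
  define B where "B = (LINT x|lebesgue_on \<Omega>. norm (weak_gradient \<Omega> v x - gradient \<phi> x) powr p)"
  have AB: "A \<ge> 0" "B \<ge> 0" by (auto simp: A_def B_def intro: integral_nonneg_AE)
  have "p_energy p (\<lambda>x. v x - \<phi> x) \<Omega> = B"
    unfolding B_def
  proof (rule p_energy_eq[OF \<Omega>])
    show "has_weak_gradient (\<lambda>x. v x - \<phi> x) (\<lambda>x. weak_gradient \<Omega> v x - gradient \<phi> x) \<Omega>"
      by (intro has_weak_gradient_diff weak_gradient_W1p[OF \<Omega> v1] has_weak_gradient_test_function \<phi>)
    show "(\<lambda>x. weak_gradient \<Omega> v x - gradient \<phi> x) \<in> Lp_space p \<Omega>"
      using p by (intro Lp_space_diff weak_gradient_W1p[OF \<Omega> v1] Lp_space_test_function \<phi>) auto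
  qed
  then have "W1p_norm p \<Omega> (\<lambda>x. v x - \<phi> x) = (A + B) powr (1 / p)"
    by (simp add: W1p_norm_def p_energy_def A_def set_lebesgue_integral_eq_lebesgue_on)
  then have "(A + B) powr (1 / p) < \<eta> powr (1 / p)" using \<phi>(2) by simp
  then have "A + B < \<eta>"
    using powr_mono2[of "1 / p" \<eta> "A + B"] p \<open>0 < \<eta>\<close> by (auto simp: not_less[symmetric])
  then have "A < \<eta>" "B < \<eta>" using AB by linarith+
  then show ?thesis by (intro that[OF \<phi>(1)]) (simp_all only: A_def B_def)
qed

text \<open>The flux has norm \<open>norm (f x) powr (p - 1)\<close>, so Young's inequality can be
  integrated pointwise. The weight \<epsilon> stays free to be matched to the size of
  \<open>d\<close>.\<close>

lemma duality_pairing: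
  fixes f d :: "'a::euclidean_space \<Rightarrow> 'b::euclidean_space"
  assumes \<Omega>: "\<Omega> \<in> sets lebesgue" and p: "1 < p" and f: "f \<in> Lp_space p \<Omega>" and d: "d \<in> Lp_space p \<Omega>"
  shows "integrable (lebesgue_on \<Omega>) (\<lambda>x. (norm (f x) powr (p - 2) *\<^sub>R f x) \<bullet> d x)"
    and "0 < \<epsilon> \<Longrightarrow> \<bar>LINT x|lebesgue_on \<Omega>. (norm (f x) powr (p - 2) *\<^sub>R f x) \<bullet> d x\<bar> \<le>
      \<epsilon> * (LINT x|lebesgue_on \<Omega>. norm (f x) powr p) + \<epsilon> powr (1 - p) * (LINT x|lebesgue_on \<Omega>. norm (d x) powr p)"
proof -
  note * = f[unfolded Lp_space_iff[OF \<Omega>]] d[unfolded Lp_space_iff[OF \<Omega>]]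
  have [measurable]: "f \<in> borel_measurable (lebesgue_on \<Omega>)" "d \<in> borel_measurable (lebesgue_on \<Omega>)"
    using * by auto
  let ?g = "\<lambda>x. (norm (f x) powr (p - 2) *\<^sub>R f x) \<bullet> d x"
  have le: "\<bar>?g x\<bar> \<le> \<epsilon> * norm (f x) powr p + \<epsilon> powr (1 - p) * norm (d x) powr p" if "0 < \<epsilon>" for x \<epsilon>
  proof -
    have "\<bar>?g x\<bar> \<le> norm (norm (f x) powr (p - 2) *\<^sub>R f x) * norm (d x)"
      by (rule Cauchy_Schwarz_ineq2)
    also have "norm (norm (f x) powr (p - 2) *\<^sub>R f x) = norm (f x) powr (p - 1)"
      using powr_mult_base[of "norm (f x)" "p - 2"] by (cases "f x = 0") (auto simp: mult.commute)
    also have "\<dots> * norm (d x) \<le> \<epsilon> * norm (f x) powr p + \<epsilon> powr (1 - p) * norm (d x) powr p"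
      using p that by (intro powr_mult_le) auto
    finally show ?thesis .
  qed
  have int: "integrable (lebesgue_on \<Omega>) (\<lambda>x. \<epsilon> * norm (f x) powr p + \<epsilon> powr (1 - p) * norm (d x) powr p)" for \<epsilon>
    using * by auto
  show g: "integrable (lebesgue_on \<Omega>) ?g"
  proof (rule Bochner_Integration.integrable_bound[OF int[of 1]])
    show "AE x in lebesgue_on \<Omega>. norm (?g x) \<le> norm (1 * norm (f x) powr p + 1 powr (1 - p) * norm (d x) powr p)"
      using le[of 1] by (intro AE_I2) (auto intro: order_trans)
  qed measurable
  show "\<bar>LINT x|lebesgue_on \<Omega>. ?g x\<bar> \<le>
      \<epsilon> * (LINT x|lebesgue_on \<Omega>. norm (f x) powr p) + \<epsilon> powr (1 - p) * (LINT x|lebesgue_on \<Omega>. norm (d x) powr p)"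
    if "0 < \<epsilon>"
  proof -
    have "\<bar>LINT x|lebesgue_on \<Omega>. ?g x\<bar> \<le> (LINT x|lebesgue_on \<Omega>. \<bar>?g x\<bar>)"
      by (rule integral_abs_bound)
    also have "\<dots> \<le> (LINT x|lebesgue_on \<Omega>. \<epsilon> * norm (f x) powr p + \<epsilon> powr (1 - p) * norm (d x) powr p)"
      using g int[of \<epsilon>] le[OF that] by (intro integral_mono) auto
    finally show ?thesis using * by simp
  qed
qed

text \<open>For an approximant \<phi> within \<eta>, the integral of the p-th power of its gradient
  is below \<eta>, because the gradient of \<open>v\<close> vanishes. Poincare then bounds \<phi> by
  \<open>C * \<eta>\<close>, hence \<open>v\<close> by a fixed multiple of \<eta>.\<close>

lemma W1p_0_zero_gradient:
  fixes v :: "'a::euclidean_space \<Rightarrow> real"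
  assumes \<Omega>: "open \<Omega>" "bounded \<Omega>" and p: "1 < p" and v: "v \<in> W1p_0 p \<Omega>"
    and zero: "AE x in lebesgue_on \<Omega>. weak_gradient \<Omega> v x = 0"
  shows "AE x in lebesgue_on \<Omega>. v x = 0"
proof -
  have [simp]: "\<Omega> \<in> sets lebesgue" using \<Omega> by simp
  have v1: "v \<in> W1p p \<Omega>" using v by (simp add: W1p_0_def)
  then have vL: "v \<in> Lp_space p \<Omega>" by (simp add: W1p_def)
  obtain C where C: "C \<ge> 0" "\<And>\<phi>. \<phi> \<in> test_functions \<Omega> \<Longrightarrow>
       (LINT x:\<Omega>|lebesgue. \<bar>\<phi> x\<bar> powr p) \<le> C * (LINT x:\<Omega>|lebesgue. norm (gradient \<phi> x) powr p)"
    using Poincare_test_functions[OF \<Omega>(2) p] by blast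
  have bound: "(LINT x|lebesgue_on \<Omega>. \<bar>v x\<bar> powr p) \<le> 2 powr p * (1 + C) * \<eta>" if "\<eta> > 0" for \<eta>
  proof -
    obtain \<phi> where \<phi>: "\<phi> \<in> test_functions \<Omega>"
      "(LINT x|lebesgue_on \<Omega>. \<bar>v x - \<phi> x\<bar> powr p) < \<eta>"
      "(LINT x|lebesgue_on \<Omega>. norm (weak_gradient \<Omega> v x - gradient \<phi> x) powr p) < \<eta>"
      using W1p_0_approx[OF \<Omega>(1) p v \<open>\<eta> > 0\<close>] by blast
    have gL: "gradient \<phi> \<in> Lp_space p \<Omega>" "\<phi> \<in> Lp_space p \<Omega>"
      using p by (auto intro: Lp_space_test_function \<phi>)
    have vphi: "(\<lambda>x. v x - \<phi> x) \<in> Lp_space p \<Omega>"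
      using p vL gL by (intro Lp_space_diff) auto
    have meas: "gradient \<phi> \<in> borel_measurable (lebesgue_on \<Omega>)" "weak_gradient \<Omega> v \<in> borel_measurable (lebesgue_on \<Omega>)"
      using gL weak_gradient_W1p(2)[OF \<Omega>(1) v1] by (auto simp: Lp_space_iff)
    note [measurable] = meas
    have "(LINT x|lebesgue_on \<Omega>. norm (gradient \<phi> x) powr p) =
        (LINT x|lebesgue_on \<Omega>. norm (weak_gradient \<Omega> v x - gradient \<phi> x) powr p)"
      by (rule integral_cong_AE) (measurable, use zero in \<open>auto elim: eventually_mono\<close>)
    then have "C * (LINT x|lebesgue_on \<Omega>. norm (gradient \<phi> x) powr p) \<le> C * \<eta>"
      using \<phi>(3) C(1) by (intro mult_left_mono) auto
    then have phi: "(LINT x|lebesgue_on \<Omega>. \<bar>\<phi> x\<bar> powr p) \<le> C * \<eta>"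
      using C(2)[OF \<phi>(1)] by (simp add: set_lebesgue_integral_eq_lebesgue_on)
    have ints: "integrable (lebesgue_on \<Omega>) (\<lambda>x. \<bar>v x\<bar> powr p)"
      "integrable (lebesgue_on \<Omega>) (\<lambda>x. \<bar>v x - \<phi> x\<bar> powr p)" "integrable (lebesgue_on \<Omega>) (\<lambda>x. \<bar>\<phi> x\<bar> powr p)"
      using vL vphi gL by (auto simp: Lp_space_iff)
    have "(LINT x|lebesgue_on \<Omega>. \<bar>v x\<bar> powr p) \<le>
        (LINT x|lebesgue_on \<Omega>. 2 powr p * (\<bar>v x - \<phi> x\<bar> powr p + \<bar>\<phi> x\<bar> powr p))"
    proof (rule integral_mono)
      show "\<bar>v x\<bar> powr p \<le> 2 powr p * (\<bar>v x - \<phi> x\<bar> powr p + \<bar>\<phi> x\<bar> powr p)" for x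
        using norm_add_powr_le[of p "v x - \<phi> x" "\<phi> x"] p by simp
    qed (use ints in auto)
    also have "\<dots> = 2 powr p * ((LINT x|lebesgue_on \<Omega>. \<bar>v x - \<phi> x\<bar> powr p) + (LINT x|lebesgue_on \<Omega>. \<bar>\<phi> x\<bar> powr p))"
      using ints by simp
    also have "\<dots> \<le> 2 powr p * (\<eta> + C * \<eta>)"
      using \<phi>(2) phi by (intro mult_left_mono) auto
    finally show ?thesis by (simp add: algebra_simps)
  qed
  have "(LINT x|lebesgue_on \<Omega>. \<bar>v x\<bar> powr p) \<le> 0"
  proof (rule field_le_epsilon)
    fix e :: real assume "e > 0"
    then show "(LINT x|lebesgue_on \<Omega>. \<bar>v x\<bar> powr p) \<le> 0 + e"
      using bound[of "e / (2 powr p * (1 + C))"] C(1) by (simp add: add_pos_nonneg)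
  qed
  moreover have "(LINT x|lebesgue_on \<Omega>. \<bar>v x\<bar> powr p) \<ge> 0" by (auto intro: integral_nonneg_AE)
  ultimately have "AE x in lebesgue_on \<Omega>. \<bar>v x\<bar> powr p = 0"
    using vL by (subst integral_nonneg_eq_0_iff_AE[symmetric]) (auto simp: Lp_space_iff)
  then show ?thesis by eventually_elim simp
qed

lemma p_harmonic_pairing_W1p_0:
  fixes u h :: "'a::euclidean_space \<Rightarrow> real"
  assumes \<Omega>: "open \<Omega>" and p: "1 < p" and u: "u \<in> W1p p \<Omega>" and harm: "p_harmonic_on p \<Omega> u"
    and h: "h \<in> W1p_0 p \<Omega>"
  shows "(LINT x|lebesgue_on \<Omega>. (norm (weak_gradient \<Omega> u x) powr (p - 2) *\<^sub>R weak_gradient \<Omega> u x) \<bullet> weak_gradient \<Omega> h x) = 0"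
    (is "?I = 0")
proof (rule ccontr)
  assume "?I \<noteq> 0"
  have [simp]: "\<Omega> \<in> sets lebesgue" using \<Omega> by simp
  note gu = weak_gradient_W1p(2)[OF \<Omega> u]
  have gh: "weak_gradient \<Omega> h \<in> Lp_space p \<Omega>"
    using h by (intro weak_gradient_W1p(2)[OF \<Omega>]) (simp add: W1p_0_def)
  let ?X = "\<lambda>x. norm (weak_gradient \<Omega> u x) powr (p - 2) *\<^sub>R weak_gradient \<Omega> u x"
  define A where "A = (LINT x|lebesgue_on \<Omega>. norm (weak_gradient \<Omega> u x) powr p)"
  have "A \<ge> 0" by (auto simp: A_def intro: integral_nonneg_AE)
  have bound: "\<bar>?I\<bar> \<le> \<epsilon> * (A + 1)" if "\<epsilon> > 0" for \<epsilon>
  proof -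
    \<comment> \<open>The accuracy \<open>\<epsilon> powr p\<close> cancels the weight
      \<open>\<epsilon> powr (1 - p)\<close> down to \<epsilon>, so the total error is
      \<open>\<epsilon> * (A + 1)\<close> with \<open>A\<close> independent of \<epsilon>.\<close>
    have "\<epsilon> powr p > 0" using that by simp
    from W1p_0_approx[OF \<Omega> p h this] obtain \<phi> where \<phi>: "\<phi> \<in> test_functions \<Omega>"
      "(LINT x|lebesgue_on \<Omega>. norm (weak_gradient \<Omega> h x - gradient \<phi> x) powr p) < \<epsilon> powr p"
      by blast
    have g\<phi>: "gradient \<phi> \<in> Lp_space p \<Omega>"
      using p by (auto intro: Lp_space_test_function \<phi>)
    have d: "(\<lambda>x. weak_gradient \<Omega> h x - gradient \<phi> x) \<in> Lp_space p \<Omega>"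
      using p gh g\<phi> by (intro Lp_space_diff) auto
    have "(LINT x|lebesgue_on \<Omega>. ?X x \<bullet> gradient \<phi> x) = 0"
      using harm \<phi>(1) by (simp add: p_harmonic_on_def set_lebesgue_integral_eq_lebesgue_on)
    then have "?I = (LINT x|lebesgue_on \<Omega>. ?X x \<bullet> (weak_gradient \<Omega> h x - gradient \<phi> x))"
      using duality_pairing(1)[OF _ p gu gh] duality_pairing(1)[OF _ p gu g\<phi>]
      by (simp add: inner_diff_right del: inner_scaleR_left)
    then have "\<bar>?I\<bar> \<le> \<epsilon> * A + \<epsilon> powr (1 - p) * (LINT x|lebesgue_on \<Omega>. norm (weak_gradient \<Omega> h x - gradient \<phi> x) powr p)"
      using duality_pairing(2)[OF _ p gu d that] by (simp add: A_def)
    also have "\<dots> \<le> \<epsilon> * A + \<epsilon> powr (1 - p) * \<epsilon> powr p"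
      using \<phi>(2) by (intro add_left_mono mult_left_mono) auto
    also have "\<epsilon> powr (1 - p) * \<epsilon> powr p = \<epsilon>"
      using that by (simp add: powr_add[symmetric])
    finally show ?thesis by (simp add: algebra_simps)
  qed
  define \<epsilon> where "\<epsilon> = \<bar>?I\<bar> / (2 * (A + 1))"
  have "\<epsilon> > 0" using \<open>?I \<noteq> 0\<close> \<open>A \<ge> 0\<close> by (simp add: \<epsilon>_def)
  moreover have "\<epsilon> * (A + 1) = \<bar>?I\<bar> / 2" using \<open>A \<ge> 0\<close> by (simp add: \<epsilon>_def field_simps)
  ultimately show False using bound[of \<epsilon>] \<open>?I \<noteq> 0\<close> by simp
qed

lemma p_energy_minimal:
  fixes u w :: "'a::euclidean_space \<Rightarrow> real"
  assumes \<Omega>: "open \<Omega>" "bounded \<Omega>" and p: "1 < p" and u: "u \<in> W1p p \<Omega>" and harm: "p_harmonic_on p \<Omega> u"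
    and w: "(\<lambda>x. w x - u x) \<in> W1p_0 p \<Omega>"
  shows "p_energy p u \<Omega> \<le> p_energy p w \<Omega>"
    and "p_energy p w \<Omega> = p_energy p u \<Omega> \<longleftrightarrow> (AE x in lebesgue_on \<Omega>. w x = u x)"
proof -
  have [simp]: "\<Omega> \<in> sets lebesgue" using \<Omega> by simp
  define h where "h x = w x - u x" for x
  have h: "h \<in> W1p_0 p \<Omega>" using w by (simp add: h_def[abs_def])
  then have h1: "h \<in> W1p p \<Omega>" by (simp add: W1p_0_def)
  define a where "a = weak_gradient \<Omega> u"
  define d where "d = weak_gradient \<Omega> h"
  have a: "has_weak_gradient u a \<Omega>" "a \<in> Lp_space p \<Omega>"
    using weak_gradient_W1p[OF \<Omega>(1) u] by (auto simp: a_def)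
  have d: "has_weak_gradient h d \<Omega>" "d \<in> Lp_space p \<Omega>"
    using weak_gradient_W1p[OF \<Omega>(1) h1] by (auto simp: d_def)
  \<comment> \<open>Only \<open>w - u\<close> is assumed to be a Sobolev function; a weak gradient
    of \<open>w\<close> arises from \<open>w = u + h\<close>.\<close>
  have "has_weak_gradient w (\<lambda>x. a x + d x) \<Omega>"
    using has_weak_gradient_add[OF a(1) d(1)] by (simp add: h_def)
  moreover have adL: "(\<lambda>x. a x + d x) \<in> Lp_space p \<Omega>"
    using p a d by (intro Lp_space_add) auto
  ultimately have Ew: "p_energy p w \<Omega> = (LINT x|lebesgue_on \<Omega>. norm (a x + d x) powr p)"
    by (rule p_energy_eq[OF \<Omega>(1)])
  have Eu: "p_energy p u \<Omega> = (LINT x|lebesgue_on \<Omega>. norm (a x) powr p)"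
    by (rule p_energy_eq[OF \<Omega>(1) a])
  let ?X = "\<lambda>x. (norm (a x) powr (p - 2) *\<^sub>R a x) \<bullet> d x"
  \<comment> \<open>The Bregman gap of the p-th power of the norm between \<open>a x\<close> and
    \<open>a x + d x\<close>.\<close>
  define D where "D x = norm (a x + d x) powr p - norm (a x) powr p - p * ?X x" for x
  have ints: "integrable (lebesgue_on \<Omega>) (\<lambda>x. norm (a x + d x) powr p)"
    "integrable (lebesgue_on \<Omega>) (\<lambda>x. norm (a x) powr p)" "integrable (lebesgue_on \<Omega>) ?X"
    using adL a duality_pairing(1)[OF _ p a(2) d(2)] by (auto simp: Lp_space_iff)
  then have Dint: "integrable (lebesgue_on \<Omega>) D"
    unfolding D_def by (intro Bochner_Integration.integrable_diff integrable_mult_right)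
  have D0: "0 \<le> D x" for x using norm_powr_tangent(1)[OF p, of "a x" "d x"] by (simp add: D_def)
  have Dz: "D x = 0 \<longleftrightarrow> d x = 0" for x
    using norm_powr_tangent(2)[OF p, of "d x" "a x"] by (cases "d x = 0") (auto simp: D_def)
  have "(LINT x|lebesgue_on \<Omega>. ?X x) = 0"
    using p_harmonic_pairing_W1p_0[OF \<Omega>(1) p u harm h] by (simp add: a_def d_def)
  then have Deq: "(LINT x|lebesgue_on \<Omega>. D x) = p_energy p w \<Omega> - p_energy p u \<Omega>"
    unfolding D_def Ew Eu using ints by (simp del: inner_scaleR_left)
  show "p_energy p u \<Omega> \<le> p_energy p w \<Omega>"
    using Deq D0 integral_nonneg_AE[of D "lebesgue_on \<Omega>"] by simp
  have "p_energy p w \<Omega> = p_energy p u \<Omega> \<longleftrightarrow> (LINT x|lebesgue_on \<Omega>. D x) = 0"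
    by (simp add: Deq)
  also have "\<dots> \<longleftrightarrow> (AE x in lebesgue_on \<Omega>. d x = 0)"
    using Dint D0 by (simp add: integral_nonneg_eq_0_iff_AE Dz)
  also have "\<dots> \<longleftrightarrow> (AE x in lebesgue_on \<Omega>. h x = 0)"
  proof
    assume "AE x in lebesgue_on \<Omega>. d x = 0"
    then show "AE x in lebesgue_on \<Omega>. h x = 0"
      unfolding d_def by (rule W1p_0_zero_gradient[OF \<Omega> p h])
  next
    assume "AE x in lebesgue_on \<Omega>. h x = 0"
    then have "AE x in lebesgue. x \<in> \<Omega> \<longrightarrow> h x = 0" by (subst (asm) AE_restrict_space_iff) auto
    moreover have "h locally_integrable_on \<Omega>" using d(1) by (simp add: has_weak_gradient_def)
    ultimately have "has_weak_gradient h (\<lambda>_. 0) \<Omega>" by (intro has_weak_gradient_AE_0)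
    then show "AE x in lebesgue_on \<Omega>. d x = 0"
      unfolding d_def by (rule weak_gradient_AE_eq[OF \<Omega>(1)])
  qed
  finally show "p_energy p w \<Omega> = p_energy p u \<Omega> \<longleftrightarrow> (AE x in lebesgue_on \<Omega>. w x = u x)"
    by (simp add: h_def)
qed

text \<open>The derivatives are unrestricted ones, so equality on \<open>S\<close> passes to them
  only because \<open>S\<close> is a neighbourhood of each of its points.\<close>

lemma Ck_on_cong_open:
  assumes "open S" and "\<And>x. x \<in> S \<Longrightarrow> f x = g x" and "Ck_on k S f"
  shows "Ck_on k S g"
  using assms(2,3)
proof (induction k arbitrary: f g)
  case 0
  then show ?case using continuous_on_cong[of S S f g] by simp
next
  case (Suc k)
  have d: "(g has_derivative frechet_derivative f (at x)) (at x)" if "x \<in> S" for x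
  proof (rule has_derivative_transform_within_open[of f _ _ UNIV, OF _ assms(1) that])
    show "(f has_derivative frechet_derivative f (at x)) (at x)"
      using Suc.prems(2) that by (simp add: frechet_derivative_works[symmetric])
  qed (rule Suc.prems(1))
  have eq: "partial_deriv f b x = partial_deriv g b x" if "x \<in> S" for b x
    using partial_deriv_eq[OF d[OF that]] by (simp add: partial_deriv_def)
  have "Ck_on k S (partial_deriv g b)" if "b \<in> Basis" for b
  proof (rule Suc.IH[OF eq])
    show "Ck_on k S (partial_deriv f b)" using Suc.prems(2) that by simp
  qed
  then show ?case using d by (auto simp: differentiable_def)
qed

text \<open>The set where the two functions differ is open and null, hence empty.\<close>

lemma continuous_AE_eq_imp_eq:
  fixes v w :: "'a::euclidean_space \<Rightarrow> real"
  assumes \<Omega>: "open \<Omega>" and v: "continuous_on \<Omega> v" and w: "continuous_on \<Omega> w"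
    and ae: "AE x in lebesgue_on \<Omega>. v x = w x" and x: "x \<in> \<Omega>"
  shows "v x = w x"
proof -
  have "open (\<Omega> \<inter> (\<lambda>x. v x - w x) -` (- {0}))"
    using \<Omega> v w by (intro continuous_open_preimage continuous_intros) auto
  moreover have "AE x in lebesgue. x \<in> \<Omega> \<longrightarrow> v x = w x"
    using ae \<Omega> by (subst (asm) AE_restrict_space_iff) auto
  \<comment> \<open>Almost every point of this open set lies in the empty set, which is closed, so
    by the closed-set principle applied below every point of it does.\<close>
  then have "AE x \<in> \<Omega> \<inter> (\<lambda>x. v x - w x) -` (- {0}) in lebesgue. x \<in> {}"
    by eventually_elim auto
  ultimately have "x \<notin> \<Omega> \<inter> (\<lambda>x. v x - w x) -` (- {0})"
    using mem_closed_if_AE_lebesgue_open[OF _ closed_empty] by blast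
  then show ?thesis using x by simp
qed

theorem proposition2p4:
  fixes \<Omega> :: "(real ^ 'n) set" and p :: real and u :: "real ^ 'n \<Rightarrow> real"
  assumes "open \<Omega>" and "bounded \<Omega>"
    and "1 < p"
    and "continuous_on \<Omega> u" and "u \<in> W1p p \<Omega>"
    and "p_harmonic_on p \<Omega> u"
  shows "(\<forall>w. (\<lambda>x. w x - u x) \<in> W1p_0 p \<Omega> \<longrightarrow>
            p_energy p w \<Omega> \<ge> p_energy p u \<Omega> \<and>
            (p_energy p w \<Omega> = p_energy p u \<Omega> \<longleftrightarrow> (AE x in lebesgue_on \<Omega>. w x = u x))) \<and>
         (\<forall>v. continuous_on \<Omega> v \<and> (AE x in lebesgue_on \<Omega>. v x = u x) \<and> \<not> smooth_on \<Omega> v \<longrightarrow>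
            (\<forall>w. smooth_on \<Omega> w \<and> (\<lambda>x. w x - u x) \<in> W1p_0 p \<Omega> \<longrightarrow>
               p_energy p w \<Omega> > p_energy p u \<Omega>))"
proof (intro conjI allI impI)
  note minimal = p_energy_minimal[OF assms(1-3,5,6)]
  fix w assume w: "(\<lambda>x. w x - u x) \<in> W1p_0 p \<Omega>"
  show "p_energy p w \<Omega> \<ge> p_energy p u \<Omega>"
    and "p_energy p w \<Omega> = p_energy p u \<Omega> \<longleftrightarrow> (AE x in lebesgue_on \<Omega>. w x = u x)"
    by (rule minimal[OF w])+
next
  note minimal = p_energy_minimal[OF assms(1-3,5,6)]
  fix v w
  assume v: "continuous_on \<Omega> v \<and> (AE x in lebesgue_on \<Omega>. v x = u x) \<and> \<not> smooth_on \<Omega> v"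
    and w: "smooth_on \<Omega> w \<and> (\<lambda>x. w x - u x) \<in> W1p_0 p \<Omega>"
  have "p_energy p w \<Omega> \<noteq> p_energy p u \<Omega>"
  proof
    assume "p_energy p w \<Omega> = p_energy p u \<Omega>"
    then have "AE x in lebesgue_on \<Omega>. w x = u x" using minimal(2) w by blast
    then have ae: "AE x in lebesgue_on \<Omega>. w x = v x"
      using conjunct1[OF conjunct2[OF v]] by eventually_elim simp
    have "Ck_on 0 \<Omega> w" using w unfolding smooth_on_def by blast
    then have "continuous_on \<Omega> w" by simp
    then have eq: "w x = v x" if "x \<in> \<Omega>" for x
      using continuous_AE_eq_imp_eq[OF assms(1) _ _ ae that] v by blast
    have "Ck_on k \<Omega> v" for k
      by (rule Ck_on_cong_open[OF assms(1), of w]) (use eq w in \<open>auto simp: smooth_on_def\<close>)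
    then have "smooth_on \<Omega> v" by (simp add: smooth_on_def)
    with v show False by blast
  qed
  then show "p_energy p w \<Omega> > p_energy p u \<Omega>"
    using minimal(1) w by (simp add: less_le)
qed

end
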